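(* Let $w$ be the weight system on the lecture hall graph defined by \[ w(t;i,j)=(-aq^{2i+1})^t\,q^j\qquad(t\ge0,\ 0\le j\le i). \] Then the mixed moments $\sigma^b_{n,k}(a;q)$ of the $q$-Bessel polynomials satisfy \[ \sigma^b_{n,k}(a;q)=h^w_{n,k}\qquad(n\ge k\ge0). \]
   Context: Lecture hall graph. For integers $t\ge0$, $0\le j\le i$ put $v^t_{i,j}=(i,\,t+\frac{j}{i+1})$, and set $v^t_{i,i+1}:=v^{t+1}_{i,0}$. The vertices of the lecture hall graph are all $v^t_{i,j}$; its edges join $v^t_{i,j}$ with $v^t_{i,j+1}$ (vertical edges) and $v^t_{i,j}$ with $v^t_{i+1,j}$, for $t\ge 0$, $0\le j\le i$. An east step is a directed edge $(v^t_{i,j},v^t_{i+1,j})$; a south step is a vertical edge directed downwards, $(v^t_{i,j+1},v^t_{i,j})$. A weight system $w$ assigns a weight $w(t;i,j)$ to each east step $(v^t_{i,j},v^t_{i+1,j})$. The weight $w(p)$ of a path is the product of the weights of its east steps. $\mathrm{SE}((k,\infty)\to(n,0))$ is the set of paths $(\dots,v_2,v_1,v_0)$ with $v_0=(n,0)$, $\lim_{m\to\infty}v_m=(k,\infty)$, and each $(v_{m+1},v_m)$ a south or east step. Define $h^w_{n,k}=\sum_{p\in \mathrm{SE}((k,\infty)\to(n,0))}w(p)$ (so $h^w_{n,n}=1$). $q$-Bessel polynomials. The monic $q$-Bessel (alternative $q$-Charlier) polynomials are \[ p_n(x;a;q)=\frac{1}{(-1)^nq^{-\binom n2}(-aq^n;q)_n}\;{}_2\phi_1\!\left(\begin{matrix}q^{-n},-aq^n\\0\end{matrix};q,qx\right),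 \] where ${}_2\phi_1(\alpha_1,\alpha_2;\beta;q,z)=\sum_{k\ge0}\frac{(\alpha_1;q)_k(\alpha_2;q)_k}{(q;q)_k(\beta;q)_k}z^k$ and $(z;q)_k=\prod_{i=0}^{k-1}(1-zq^i)$. The mixed moments are defined by $x^n=\sum_{k=0}^n\sigma^b_{n,k}(a;q)\,p_k(x;a;q)$. Here $a,q$ are indeterminates, and the identity is one of formal power series in $a$ with coefficients in $\mathbb{Q}(q)$ (the infinite sum $h^w_{n,k}$ gives the power series expansion of the rational function $\sigma^b_{n,k}(a;q)$). *)

theory Defs
  imports
    "HOL-Analysis.Infinite_Sum"
    "HOL-Computational_Algebra.Computational_Algebra"
    "HOL-Library.Groups_Big_Fun"
begin

section \<open>The lecture hall graph\<close>

text \<open>The identification of \<open>(t, i, i+1)\<close> with \<open>(t+1, i, 0)\<close> holds because vertices are points of the plane.\<close>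

definition lh_vertex :: "nat \<Rightarrow> nat \<Rightarrow> nat \<Rightarrow> nat \<times> real" where
  "lh_vertex t i j = (i, of_nat t + of_nat j / of_nat (i + 1))"

definition lh_vertices :: "(nat \<times> real) set" where
  "lh_vertices = {lh_vertex t i j | t i j. j \<le> i}"

definition east_step :: "nat \<times> real \<Rightarrow> nat \<times> real \<Rightarrow> bool" where
  "east_step u v \<longleftrightarrow> (\<exists>t i j. j \<le> i \<and> u = lh_vertex t i j \<and> v = lh_vertex t (i + 1) j)"

definition south_step :: "nat \<times> real \<Rightarrow> nat \<times> real \<Rightarrow> bool" where
  "south_step u v \<longleftrightarrow> (\<exists>t i j. j \<le> i \<and> u = lh_vertex t i (j + 1) \<and> v = lh_vertex t i j)"

text \<open>A path \<open>(\<dots>, v\<^sub>2, v\<^sub>1, v\<^sub>0)\<close> is the function \<open>m \<mapsto> v\<^sub>m\<close>, so it is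
  traversed towards smaller indices. Convergence to \<open>(k, \<infinity>)\<close> is stated by coordinates.\<close>

definition SE_paths :: "nat \<Rightarrow> nat \<Rightarrow> (nat \<Rightarrow> nat \<times> real) set" where
  "SE_paths k n = {v. (\<forall>m. v m \<in> lh_vertices)
      \<and> v 0 = (n, 0)
      \<and> (\<lambda>m. fst (v m)) \<longlonglongrightarrow> k
      \<and> filterlim (\<lambda>m. snd (v m)) at_top sequentially
      \<and> (\<forall>m. south_step (v (Suc m)) (v m) \<or> east_step (v (Suc m)) (v m))}"

text \<open>A weight system maps \<open>t i j\<close> to the weight of the east step leaving \<open>lh_vertex t i j\<close>.
  With \<open>j \<le> i\<close> the triple is determined by that vertex, and a path uses an east step
  at most once, so the product over the set of triples is the product over the east steps.\<close>

definition path_weight ::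
  "(nat \<Rightarrow> nat \<Rightarrow> nat \<Rightarrow> 'a::comm_monoid_mult) \<Rightarrow> (nat \<Rightarrow> nat \<times> real) \<Rightarrow> 'a" where
  "path_weight w v = (\<Prod>(t, i, j) \<in> {(t, i, j). j \<le> i \<and>
      (\<exists>m. v (Suc m) = lh_vertex t i j \<and> v m = lh_vertex t (i + 1) j)}. w t i j)"

definition lh_h ::
  "(nat \<Rightarrow> nat \<Rightarrow> nat \<Rightarrow> 'a::{comm_semiring_1, t2_space}) \<Rightarrow> nat \<Rightarrow> nat \<Rightarrow> 'a" where
  "lh_h w n k = infsum (path_weight w) (SE_paths k n)"


section \<open>Monic \<open>q\<close>-Bessel polynomials and their mixed moments\<close>

definition qpoch :: "'a::comm_ring_1 \<Rightarrow> 'a \<Rightarrow> nat \<Rightarrow> 'a" where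
  "qpoch z q k = (\<Prod>i<k. 1 - z * q ^ i)"

text \<open>The argument \<open>z\<close> is a polynomial. \<^const>\<open>Sum_any\<close> is the sum of the nonzero terms,
  so this is the hypergeometric series whenever the latter terminates.\<close>

definition phi21 :: "'a::field \<Rightarrow> 'a \<Rightarrow> 'a \<Rightarrow> 'a \<Rightarrow> 'a poly \<Rightarrow> 'a poly" where
  "phi21 \<alpha>\<^sub>1 \<alpha>\<^sub>2 \<beta> q z = Sum_any (\<lambda>k.
      smult ((qpoch \<alpha>\<^sub>1 q k * qpoch \<alpha>\<^sub>2 q k) / (qpoch q q k * qpoch \<beta> q k)) (z ^ k))"

definition qbessel :: "'a::field \<Rightarrow> 'a \<Rightarrow> nat \<Rightarrow> 'a poly" where
  "qbessel a q n =
     smult (1 / ((-1) ^ n * inverse (q ^ (n choose 2)) * qpoch (- a * q ^ n) q n))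
       (phi21 (inverse (q ^ n)) (- a * q ^ n) 0 q [:0, q:])"

definition qbessel_mixed_moment :: "'a::field \<Rightarrow> 'a \<Rightarrow> nat \<Rightarrow> nat \<Rightarrow> 'a" where
  "qbessel_mixed_moment a q n =
     (THE c. (\<forall>k>n. c k = 0) \<and> monom 1 n = (\<Sum>k\<le>n. smult (c k) (qbessel a q k)))"

definition qbessel_weight :: "'a::comm_ring_1 \<Rightarrow> 'a \<Rightarrow> nat \<Rightarrow> nat \<Rightarrow> nat \<Rightarrow> 'a" where
  "qbessel_weight a q t i j = (- a * q ^ (2 * i + 1)) ^ t * q ^ j"


section \<open>The indeterminates \<open>a\<close> and \<open>q\<close>\<close>

text \<open>\<open>\<rat>(q)\<close> and \<open>\<rat>(q)(a)\<close>.\<close>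

type_synonym ratq = "rat poly fract"
type_synonym ratqa = "ratq poly fract"

definition q_var :: ratq where "q_var = to_fract [:0, 1:]"

definition a_rat :: ratqa where "a_rat = to_fract [:0, 1:]"
definition q_rat :: ratqa where "q_rat = to_fract [:q_var:]"

definition a_fps :: "ratq fps" where "a_fps = fps_X"
definition q_fps :: "ratq fps" where "q_fps = fps_const q_var"

text \<open>The rational function \<open>r\<close> is regular at \<open>0\<close> with power series expansion \<open>f\<close>.\<close>

definition has_fps_expansion_rat :: "'a::field poly fract \<Rightarrow> 'a fps \<Rightarrow> bool" where
  "has_fps_expansion_rat r f \<longleftrightarrow>
     (\<exists>u d. coeff d 0 \<noteq> 0 \<and> r = Fract u d \<and> fps_of_poly d * f = fps_of_poly u)"

end

theory Submission
  imports Defs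
begin

text \<open>
  Both sides equal \<open>[n choose k]\<^sub>q / (-a q\<^bsup>2k+1\<^esup>; q)\<^bsub>n-k\<^esub>\<close>.
  For the mixed moments this inversion formula reduces to a telescoping sum.

  For the paths, cut at height 1. The part above height 1 is a path with all weights shifted, and
  the part below it from \<open>(m, 1)\<close> to \<open>(n, 0)\<close> is a partition in an
  \<open>(n-m) \<times> m\<close> box. The resulting recurrence is solved by the Durfee-type identity
  \<open>\<Sum>\<^sub>r [N choose r]\<^sub>q z\<^sup>r q\<^bsup>r(r-1)\<^esup> / (z; q)\<^sub>r = 1 / (z; q)\<^sub>N\<close>.
  The explicit generating functions of the paths ending at an arbitrary vertex are
  checked against the recurrence that removes the last step; the recurrence determines each
  coefficient of \<open>a\<close>, since paths that end high up on a column \<open>i > k\<close> carry a high power of \<open>a\<close>.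
\<close>

section \<open>Gaussian binomial coefficients\<close>

lemma qpoch_0 [simp]: "qpoch z q 0 = 1"
  by (simp add: qpoch_def)

lemma qpoch_Suc: "qpoch z q (Suc n) = qpoch z q n * (1 - z * q ^ n)"
  by (simp add: qpoch_def)

lemma qpoch_Suc_left: "qpoch z q (Suc n) = (1 - z) * qpoch (z * q) q n"
  by (simp add: qpoch_def prod.lessThan_Suc_shift mult.assoc del: prod.lessThan_Suc)

lemma qpoch_add: "qpoch z q (m + n) = qpoch z q m * qpoch (z * q ^ m) q n"
  by (induction n) (simp_all add: qpoch_Suc power_add mult.assoc)

text \<open>Defined by a Pascal recurrence and not as a quotient, so that the same function makes
  sense for polynomials, power series and fractions and is respected by the maps between
  them.\<close>

fun qbin :: "'a::comm_semiring_1 \<Rightarrow> nat \<Rightarrow> nat \<Rightarrow> 'a" where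
  "qbin q N 0 = 1"
| "qbin q 0 (Suc r) = 0"
| "qbin q (Suc N) (Suc r) = qbin q N r + q ^ Suc r * qbin q N (Suc r)"

lemma qbin_eq_0: "N < r \<Longrightarrow> qbin q N r = 0"
  by (induction q N r rule: qbin.induct) auto

lemma qbin_self [simp]: "qbin q N N = 1"
  by (induction N) (auto simp: qbin_eq_0)

text \<open>The mirrored Pascal recurrence. Both terms of the defining recurrence are expanded by
  the induction hypothesis, and the four pieces are regrouped by the defining recurrence.\<close>

lemma qbin_Suc_Suc':
  "r \<le> N \<Longrightarrow> qbin q (Suc N) (Suc r) = qbin q N (Suc r) + q ^ (N - r) * qbin q N r"
proof (induction N arbitrary: r)
  case 0
  then show ?case by simp
next
  case (Suc N)
  show ?case
  proof (cases r)
    case 0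
    have "qbin q (Suc (Suc N)) (Suc 0) = 1 + q * qbin q (Suc N) (Suc 0)"
      by simp
    also have "\<dots> = 1 + q * (qbin q N (Suc 0) + q ^ N)"
      using Suc.IH[of 0] by (simp del: qbin.simps(3))
    also have "\<dots> = qbin q (Suc N) (Suc 0) + q ^ Suc N"
      by (simp add: algebra_simps)
    finally show ?thesis using 0 by simp
  next
    case (Suc s)
    show ?thesis
    proof (cases "s = N")
      case True
      then show ?thesis using Suc by (simp add: qbin_eq_0)
    next
      case False
      with Suc Suc.prems have s: "Suc s \<le> N" by simp
      define d where "d = N - Suc s"
      have d: "N - s = Suc d" "Suc N - Suc s = Suc d" "N - Suc s = d" "N = Suc s + d"
        using s by (auto simp: d_def)
      have "qbin q (Suc (Suc N)) (Suc (Suc s)) =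
          qbin q (Suc N) (Suc s) + q ^ Suc (Suc s) * qbin q (Suc N) (Suc (Suc s))"
        by simp
      also have "\<dots> = (qbin q N (Suc s) + q ^ Suc d * qbin q N s)
          + q ^ Suc (Suc s) * (qbin q N (Suc (Suc s)) + q ^ d * qbin q N (Suc s))"
        using Suc.IH[of s] Suc.IH[of "Suc s"] s d by (simp del: qbin.simps)
      also have "\<dots> = qbin q (Suc N) (Suc (Suc s)) + q ^ Suc d * qbin q (Suc N) (Suc s)"
        by (simp add: algebra_simps)
      finally show ?thesis using Suc d by simp
    qed
  qed
qed

text \<open>Exchanging \<open>r\<close> and \<open>s\<close> turns one Pascal recurrence into the
  other, hence an induction on \<open>r + s\<close>.\<close>

lemma qbin_add_symmetric: "qbin q (r + s) r = qbin q (r + s) s"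
proof (induction "r + s" arbitrary: r s)
  case 0
  then show ?case by simp
next
  case (Suc n)
  show ?case
  proof (cases "r = 0 \<or> s = 0")
    case True
    then show ?thesis by auto
  next
    case False
    then obtain r' s' where rs: "r = Suc r'" "s = Suc s'" by (metis not0_implies_Suc)
    with Suc(2) have n: "n = r' + s" "n = r + s'" "r + s = Suc n" by auto
    have IH: "qbin q n r' = qbin q n s" "qbin q n r = qbin q n s'"
      using Suc(1)[OF n(1)] Suc(1)[OF n(2)] by (simp_all only: n(1,2)[symmetric])
    have "qbin q (Suc n) (Suc r') = qbin q n r' + q ^ r * qbin q n r"
      using rs by simp
    also have "\<dots> = qbin q n s + q ^ (n - s') * qbin q n s'"
    proof -
      have "n - s' = r" using n by simp
      then show ?thesis by (simp only: IH)
    qed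
    also have "\<dots> = qbin q (Suc n) (Suc s')"
      using qbin_Suc_Suc'[of s' n q] n rs by (simp only: le_add2)
    finally show ?thesis using n(3) rs by metis
  qed
qed

lemma qbin_symmetric: "r \<le> N \<Longrightarrow> qbin q N (N - r) = qbin q N r"
  using qbin_add_symmetric[of q r "N - r"] by simp

text \<open>The factorial formula with denominators cleared, so no root of unity has to be excluded.
  The induction step rests on (1 - q^r) + q^r (1 - q^s) = 1 - q^(r+s).\<close>

lemma qbin_mult_qpoch: "qbin q (r + s) r * (qpoch q q r * qpoch q q s) = qpoch q q (r + s)"
proof (induction "r + s" arbitrary: r s)
  case 0
  then show ?case by simp
next
  case (Suc n)
  show ?case
  proof (cases "r = 0 \<or> s = 0")
    case True
    then show ?thesis by auto
  next
    case False
    then obtain r' s' where rs: "r = Suc r'" "s = Suc s'" by (metis not0_implies_Suc)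
    with Suc(2) have n: "n = r' + s" "n = r + s'" "r + s = Suc n" by auto
    let ?Q = "qpoch q q"
    have IH: "qbin q n r' * (?Q r' * ?Q s) = ?Q n" "qbin q n r * (?Q r * ?Q s') = ?Q n"
      using Suc(1)[OF n(1)] Suc(1)[OF n(2)] by (simp_all only: n(1,2)[symmetric])
    have "qbin q (r + s) r * (?Q r * ?Q s)
        = (qbin q n r' + q ^ r * qbin q n r) * (?Q r * ?Q s)"
      using rs n by simp
    also have "\<dots> = qbin q n r' * (?Q r' * ?Q s) * (1 - q * q ^ r')
        + q ^ r * (qbin q n r * (?Q r * ?Q s')) * (1 - q * q ^ s')"
      using rs by (simp add: qpoch_Suc algebra_simps)
    also have "\<dots> = ?Q n * (1 - q * q ^ r') + q ^ r * ?Q n * (1 - q * q ^ s')"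
      by (simp only: IH)
    also have "\<dots> = ?Q (Suc n)"
      using n(1) rs by (simp add: qpoch_Suc algebra_simps power_add rs(2))
    finally show ?thesis using n by simp
  qed
qed

lemma qpoch_self_nonzero:
  fixes q :: "'a::idom"
  assumes "\<And>i. 0 < i \<Longrightarrow> q ^ i \<noteq> 1"
  shows "qpoch q q n \<noteq> 0"
  using assms[of "Suc _"] by (auto simp: qpoch_def)

text \<open>Both sides are the q-trinomial coefficient with lower entries k, m - k, n - m.\<close>

lemma qbin_trinomial_revision:
  fixes q :: "'a::idom"
  assumes q: "\<And>i. 0 < i \<Longrightarrow> q ^ i \<noteq> 1" and "k \<le> m" "m \<le> n"
  shows "qbin q n m * qbin q m k = qbin q n k * qbin q (n - k) (m - k)"
proof -
  let ?Q = "qpoch q q"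
  have nz: "?Q r \<noteq> 0" for r
    using qpoch_self_nonzero[OF q] .
  have *: "qbin q N r * (?Q r * ?Q (N - r)) = ?Q N" if "r \<le> N" for N r
    using qbin_mult_qpoch[of q r "N - r"] that by simp
  \<comment> \<open>The common multiplier contains the denominators of all four binomials, so each
    one can be paired with its own; it is cancelled at the end.\<close>
  have "qbin q n m * qbin q m k * (?Q k * ?Q (m - k) * ?Q (n - m) * (?Q m * ?Q (n - k)))
      = (qbin q n m * (?Q m * ?Q (n - m))) * (qbin q m k * (?Q k * ?Q (m - k))) * ?Q (n - k)"
    by (simp add: mult_ac)
  also have "\<dots> = (qbin q n k * (?Q k * ?Q (n - k))) *
      (qbin q (n - k) (m - k) * (?Q (m - k) * ?Q (n - k - (m - k)))) * ?Q m"
    using assms(2,3) *[of m n] *[of k m] *[of k n] *[of "m - k" "n - k"] by (simp only: mult_ac diff_le_mono le_trans)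
  also have "\<dots> = qbin q n k * qbin q (n - k) (m - k)
      * (?Q k * ?Q (m - k) * ?Q (n - m) * (?Q m * ?Q (n - k)))"
    using assms(2,3) by (simp add: mult_ac)
  finally show ?thesis using nz by simp
qed

section \<open>Sums weighted by Gaussian binomials and the Durfee-type identity\<close>

lemma sum_qbin_Suc:
  fixes t :: "nat \<Rightarrow> 'a::comm_semiring_1"
  shows "(\<Sum>r\<le>Suc N. qbin q (Suc N) r * t r) = (\<Sum>r\<le>N. qbin q N r * (q ^ r * t r + t (Suc r)))"
proof -
  have "(\<Sum>r\<le>Suc N. qbin q (Suc N) r * t r)
      = t 0 + (\<Sum>r\<le>N. qbin q N r * t (Suc r)) + (\<Sum>r\<le>N. q ^ Suc r * qbin q N (Suc r) * t (Suc r))"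
    by (subst sum.atMost_Suc_shift) (simp add: sum.distrib algebra_simps)
  also have "t 0 + (\<Sum>r\<le>N. qbin q N r * t (Suc r)) + (\<Sum>r\<le>N. q ^ Suc r * qbin q N (Suc r) * t (Suc r))
     = (\<Sum>r\<le>N. qbin q N r * t (Suc r)) + (\<Sum>r\<le>Suc N. q ^ r * qbin q N r * t r)"
    by (simp only: sum.atMost_Suc_shift[of "\<lambda>r. q ^ r * qbin q N r * t r"]) (simp add: ac_simps)
  finally show ?thesis
    by (simp add: sum.distrib algebra_simps qbin_eq_0)
qed

text \<open>Pascal's rule merges neighbouring summands, and the merged summand is the one for
  \<open>z * q\<close> divided by 1 - z. Hence the induction on \<open>N\<close> generalizes
  \<open>z\<close>. The vanishing constant term of \<open>z\<close> makes every factor 1 - z q^i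
  invertible.\<close>

lemma durfee_identity:
  fixes z q :: "'a::field fps"
  assumes "z $ 0 = 0"
  shows "(\<Sum>r\<le>N. qbin q N r * (z ^ r * q ^ (r * (r - 1)) * inverse (qpoch z q r))) = inverse (qpoch z q N)"
  using assms
proof (induction N arbitrary: z)
  case 0
  then show ?case by simp
next
  case (Suc N)
  define t where "t = (\<lambda>z r. z ^ r * q ^ (r * (r - 1)) * inverse (qpoch z q r))"
  have step: "q ^ r * t z r + t z (Suc r) = inverse (1 - z) * t (z * q) r" for r
  proof -
    have "inverse (qpoch z q r)
        = inverse (qpoch z q r) * ((1 - z * q ^ r) * inverse (1 - z * q ^ r))"
      using Suc.prems by (simp add: inverse_mult_eq_1')
    also have "\<dots> = (1 - z * q ^ r) * inverse (qpoch z q (Suc r))"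
      by (simp add: qpoch_Suc fps_inverse_mult mult_ac)
    finally have 1: "inverse (qpoch z q r) = (1 - z * q ^ r) * inverse (qpoch z q (Suc r))" .
    have 2: "inverse (qpoch z q (Suc r)) = inverse (1 - z) * inverse (qpoch (z * q) q r)"
      by (simp add: qpoch_Suc_left fps_inverse_mult)
    have e: "q ^ (r + r * r) = q ^ r * q ^ r * q ^ (r * (r - 1))"
      by (cases r) (simp_all add: power_add[symmetric] algebra_simps)
    show ?thesis
      unfolding t_def 1 2
      by (simp add: e power_mult_distrib algebra_simps)
  qed
  have "(\<Sum>r\<le>Suc N. qbin q (Suc N) r * t z r) = (\<Sum>r\<le>N. qbin q N r * (inverse (1 - z) * t (z * q) r))"
    by (simp only: sum_qbin_Suc step)
  also have "\<dots> = inverse (1 - z) * (\<Sum>r\<le>N. qbin q N r * t (z * q) r)"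
    by (simp add: sum_distrib_left mult_ac)
  also have "\<dots> = inverse (1 - z) * inverse (qpoch (z * q) q N)"
    unfolding t_def by (subst Suc.IH) (use Suc.prems in simp_all)
  also have "\<dots> = inverse (qpoch z q (Suc N))"
    by (simp add: qpoch_Suc_left fps_inverse_mult)
  finally show ?case by (simp only: t_def)
qed

section \<open>Mixed moments in closed form\<close>

lemma Suc_choose_two: "Suc n choose 2 = (n choose 2) + n"
  by (simp add: numeral_2_eq_2)

lemma add_choose_two: "(l + d) choose 2 = (l choose 2) + (d choose 2) + l * d"
  by (induction d) (simp_all add: Suc_choose_two)

lemma choose_two_twice: "(l choose 2) + (l choose 2) + l = l * l"
  by (induction l) (simp_all add: Suc_choose_two)

text \<open>Reversal of the factors, each step using q^k (1 - q^(l-k)) = -q^l (1 - q^(k-l)).\<close>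

lemma qpoch_inverse_power_mult:
  fixes q :: "'a::field"
  assumes q0: "q \<noteq> 0" and "l \<le> k"
  shows "qpoch (inverse (q ^ k)) q l * q ^ (k * l) * qpoch q q (k - l) = (-1) ^ l * q ^ (l choose 2) * qpoch q q k"
  using assms(2)
proof (induction l)
  case 0
  then show ?case by (simp add: binomial_eq_0)
next
  case (Suc l)
  define d where "d = k - Suc l"
  have k: "k = Suc (l + d)" "k - Suc l = d" "k - l = Suc d"
    using Suc.prems by (auto simp: d_def)
  have "qpoch (inverse (q ^ k)) q (Suc l) * q ^ (k * Suc l) * qpoch q q (k - Suc l)
      = (q ^ k * (1 - inverse (q ^ k) * q ^ l)) * (qpoch (inverse (q ^ k)) q l * q ^ (k * l) * qpoch q q d)"
    unfolding k(2) by (simp add: qpoch_Suc power_add mult_ac)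
  also have "q ^ k * (1 - inverse (q ^ k) * q ^ l) = - (q ^ l) * (1 - q * q ^ d)"
    using q0 by (simp add: k(1) field_simps power_add)
  also have "\<dots> * (qpoch (inverse (q ^ k)) q l * q ^ (k * l) * qpoch q q d)
      = - (q ^ l) * (qpoch (inverse (q ^ k)) q l * q ^ (k * l) * (qpoch q q d * (1 - q * q ^ d)))"
    by (simp only: mult_ac)
  also have "qpoch q q d * (1 - q * q ^ d) = qpoch q q (k - l)"
    by (simp add: k(3) qpoch_Suc)
  also have "qpoch (inverse (q ^ k)) q l * q ^ (k * l) * qpoch q q (k - l)
      = (-1) ^ l * q ^ (l choose 2) * qpoch q q k"
    using Suc by simp
  finally show ?case
    by (simp add: Suc_choose_two power_add)
qed

lemma qpoch_inverse_power:
  fixes q :: "'a::field"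
  assumes q0: "q \<noteq> 0" and q1: "\<And>i. 0 < i \<Longrightarrow> q ^ i \<noteq> 1" and lk: "l \<le> k"
  shows "qpoch (inverse (q ^ k)) q l
    = (-1) ^ l * q ^ (l choose 2) * qbin q k l * qpoch q q l / q ^ (k * l)"
proof -
  have "qpoch (inverse (q ^ k)) q l * q ^ (k * l) * qpoch q q (k - l)
      = (-1) ^ l * q ^ (l choose 2) * qbin q k l * qpoch q q l * qpoch q q (k - l)"
    using qpoch_inverse_power_mult[OF q0 lk] qbin_mult_qpoch[of q l "k - l"] lk
    by (simp add: mult_ac)
  then show ?thesis
    using qpoch_self_nonzero[OF q1] q0 by (simp add: field_simps)
qed

text \<open>The factor with index \<open>k\<close> is zero; this is what terminates the
  hypergeometric series.\<close>

lemma qpoch_inverse_power_eq_0: "q \<noteq> 0 \<Longrightarrow> k < l \<Longrightarrow> qpoch (inverse (q ^ k)) q l = 0"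
  for q :: "'a::field"
  by (auto simp: qpoch_def intro!: bexI[of _ k])

text \<open>A free upper limit \<open>K\<close> gives every partial sum a closed form and allows
  induction on \<open>K\<close>. At \<open>K = Suc M\<close> the closed form contains
  \<open>qbin q M (Suc M)\<close>, so the full sum is zero.\<close>

lemma sum_qbin_telescope:
  fixes b q :: "'a::field"
  assumes b: "\<And>i. 1 - b * q ^ i \<noteq> 0" and "K \<le> Suc M"
  shows "(\<Sum>r\<le>K. (-1) ^ r * q ^ (r choose 2) * qbin q (Suc M) r * (1 - b * q ^ (2 * r))
      / qpoch (b * q ^ r) q (Suc (Suc M)))
    = (-1) ^ K * q ^ (Suc K choose 2) * qbin q M K / qpoch (b * q ^ Suc K) q (Suc M)"
  using assms(2)
proof (induction K)
  case 0
  have "qpoch (b * q) q (Suc M) \<noteq> 0"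
    using b[of "Suc _"] by (simp add: qpoch_def mult.assoc)
  moreover have "qpoch b q (Suc (Suc M)) = (1 - b) * qpoch (b * q) q (Suc M)"
    by (rule qpoch_Suc_left)
  ultimately show ?case using b[of 0]
    by (simp add: binomial_eq_0)
next
  case (Suc K)
  \<comment> \<open>\<open>D\<close> is the denominator of the new summand; the closed forms for
    \<open>K\<close> and \<open>Suc K\<close> each lack one of its end factors.\<close>
  define D where "D = qpoch (b * q ^ Suc K) q (Suc (Suc M))"
  have nz: "qpoch (b * q ^ m) q n \<noteq> 0" for m n
    using b[of "m + _"] by (simp add: qpoch_def power_add mult.assoc)
  have "D = qpoch (b * q ^ Suc K) q (Suc M) * (1 - b * q ^ (Suc K + Suc M))"
    unfolding D_def by (subst qpoch_Suc) (simp only: power_add mult.assoc)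
  then have e1: "1 / qpoch (b * q ^ Suc K) q (Suc M) = (1 - b * q ^ (Suc K + Suc M)) / D"
    using nz[of "Suc K" "Suc M"] b[of "Suc K + Suc M"] by (metis nonzero_divide_mult_cancel_right)
  have "D = (1 - b * q ^ Suc K) * qpoch (b * q ^ Suc (Suc K)) q (Suc M)"
    unfolding D_def by (subst qpoch_Suc_left) (simp only: power_Suc mult_ac)
  then have e2: "1 / qpoch (b * q ^ Suc (Suc K)) q (Suc M) = (1 - b * q ^ Suc K) / D"
    using nz[of "Suc (Suc K)" "Suc M"] b[of "Suc K"] by (metis nonzero_divide_mult_cancel_left)
  \<comment> \<open>The identity \<open>key\<close> below is linear in \<open>b\<close>. Its
    constant part is the defining Pascal recurrence \<open>p1\<close>; its part linear in
    \<open>b\<close> is the mirrored one, multiplied by q^(2K+2), which is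
    \<open>p2\<close>.\<close>
  have p1: "qbin q (Suc M) (Suc K) = qbin q M K + q ^ Suc K * qbin q M (Suc K)"
    by simp
  have p2: "q ^ Suc K * q ^ Suc K * qbin q (Suc M) (Suc K)
      = q ^ Suc K * q ^ Suc K * qbin q M (Suc K) + q ^ (Suc K + Suc M) * qbin q M K"
  proof -
    have "q ^ Suc K * q ^ Suc K * qbin q (Suc M) (Suc K)
        = q ^ Suc K * q ^ Suc K * qbin q M (Suc K) + (q ^ Suc K * q ^ Suc K * q ^ (M - K)) * qbin q M K"
      using qbin_Suc_Suc'[of K M q] Suc.prems by (simp only: distrib_left mult.assoc Suc_le_mono)
    also have "q ^ Suc K * q ^ Suc K * q ^ (M - K) = q ^ (Suc K + Suc M)"
    proof -
      have "Suc K + Suc K + (M - K) = Suc K + Suc M" using Suc.prems by simp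
      then show ?thesis by (metis power_add)
    qed
    finally show ?thesis .
  qed
  have "x * (1 - b * R) - w * (1 - b * (Q * Q)) = - (Q * y * (1 - b * Q))"
    if "w = x + Q * y" "Q * Q * w = Q * Q * y + R * x" for x y w Q R :: 'a
  proof -
    have "x * (1 - b * R) - w * (1 - b * (Q * Q)) = x - w + b * (Q * Q * w - R * x)"
      by (simp add: algebra_simps)
    also have "\<dots> = x - w + b * (Q * Q * y)"
      by (simp add: that(2))
    finally show ?thesis
      by (simp add: that(1) algebra_simps)
  qed
  from this[OF p1 p2]
  have key: "qbin q M K * (1 - b * q ^ (Suc K + Suc M)) - qbin q (Suc M) (Suc K) * (1 - b * q ^ (2 * Suc K))
      = - (q ^ Suc K * qbin q M (Suc K) * (1 - b * q ^ Suc K))"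
    by (simp only: mult_2 power_add)
  let ?f = "\<lambda>r. (-1) ^ r * q ^ (r choose 2) * qbin q (Suc M) r * (1 - b * q ^ (2 * r))
      / qpoch (b * q ^ r) q (Suc (Suc M))"
  have "(\<Sum>r\<le>Suc K. ?f r) = (-1) ^ K * q ^ (Suc K choose 2) * qbin q M K *
      (1 / qpoch (b * q ^ Suc K) q (Suc M)) + ?f (Suc K)"
    using Suc by (simp del: qbin.simps)
  also have "\<dots> = (-1) ^ K * q ^ (Suc K choose 2) *
      (qbin q M K * (1 - b * q ^ (Suc K + Suc M)) - qbin q (Suc M) (Suc K) * (1 - b * q ^ (2 * Suc K))) / D"
  proof -
    have sgn: "(- 1 :: 'a) ^ Suc K = - ((- 1) ^ K)" by simp
    show ?thesis
      unfolding e1 D_def[symmetric] sgn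
      by (simp add: diff_divide_distrib add_divide_distrib algebra_simps del: qbin.simps power_Suc)
  qed
  also have "\<dots> = (-1) ^ Suc K * (q ^ (Suc K choose 2) * q ^ Suc K) * qbin q M (Suc K) * ((1 - b * q ^ Suc K) / D)"
    unfolding key by simp
  also have "\<dots> = (-1) ^ Suc K * q ^ (Suc (Suc K) choose 2) * qbin q M (Suc K)
      / qpoch (b * q ^ Suc (Suc K)) q (Suc M)"
    unfolding e2[symmetric] Suc_choose_two[of "Suc K"] power_add by simp
  finally show ?case .
qed

section \<open>The expansion of x^n in q-Bessel polynomials\<close>

context
  fixes a q :: "'a::field"
  assumes q0: "q \<noteq> 0" and q1: "\<And>i. 0 < i \<Longrightarrow> q ^ i \<noteq> 1" and aq: "\<And>i. 1 + a * q ^ i \<noteq> 0"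
begin

lemma qpoch_nonzero: "qpoch (- a * q ^ m) q n \<noteq> 0"
  using aq[of "m + _"] by (simp add: qpoch_def power_add mult.assoc)

text \<open>The normalizing product splits after \<open>l\<close> factors, and its first part
  cancels against the numerator of the series. Taking \<open>l = k\<close> shows that the polynomial
  is monic.\<close>

lemma coeff_qbessel:
  "coeff (qbessel a q k) l =
     (if l \<le> k then (-1) ^ (k - l) * q ^ ((k - l) choose 2) * qbin q k l / qpoch (- a * q ^ (k + l)) q (k - l)
      else 0)"
proof -
  define c where "c = (\<lambda>l. qpoch (inverse (q ^ k)) q l * qpoch (- a * q ^ k) q l / (qpoch q q l * qpoch 0 q l))"
  have c0: "c l = 0" if "k < l" for l
    using qpoch_inverse_power_eq_0[OF q0 that] by (simp add: c_def)
  have X: "[:0, q:] ^ l = monom (q ^ l) l" for l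
    by (induction l) (simp_all add: monom_Suc monom_0 one_pCons smult_monom)
  have "phi21 (inverse (q ^ k)) (- a * q ^ k) 0 q [:0, q:] = Sum_any (\<lambda>l. smult (c l) ([:0, q:] ^ l))"
    by (simp only: phi21_def c_def)
  also have "\<dots> = (\<Sum>l\<le>k. smult (c l) ([:0, q:] ^ l))"
    by (rule Sum_any.expand_superset) (auto, metis c0 linorder_not_le)
  also have "\<dots> = (\<Sum>l\<le>k. monom (c l * q ^ l) l)"
    by (simp add: X smult_monom)
  finally have phi: "coeff (phi21 (inverse (q ^ k)) (- a * q ^ k) 0 q [:0, q:]) l
      = (if l \<le> k then c l * q ^ l else 0)"
    by (simp add: coeff_sum)
  show ?thesis
  proof (cases "l \<le> k")
    case False
    then show ?thesis unfolding qbessel_def coeff_smult phi by simp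
  next
    case True
    define d where "d = k - l"
    have k: "k = l + d" using True by (simp add: d_def)
    have 0: "qpoch 0 q l = 1" by (simp add: qpoch_def)
    have nz: "qpoch (- a * q ^ k) q l \<noteq> 0" "qpoch q q l \<noteq> 0" "qpoch (- a * q ^ (k + l)) q d \<noteq> 0"
      using qpoch_nonzero qpoch_self_nonzero[OF q1] by auto
    have split: "qpoch (- a * q ^ k) q k = qpoch (- a * q ^ k) q l * qpoch (- a * q ^ (k + l)) q d"
      using qpoch_add[of "- a * q ^ k" q l d] by (simp add: k[symmetric] power_add mult.assoc)
    have sgn: "(-1) ^ k * (-1) ^ l = ((-1) ^ d :: 'a)"
      by (simp add: k power_add mult_ac flip: power_mult_distrib)
    \<comment> \<open>The exponents of \<open>q\<close> come from the normalization, from the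
      reversed Pochhammer symbol and from the argument q x of the series.\<close>
    have "(k choose 2) + (l choose 2) + l = (d choose 2) + k * l"
      using choose_two_twice[of l] by (simp add: k add_choose_two algebra_simps)
    then have pw: "q ^ (k choose 2) * q ^ (l choose 2) * q ^ l = q ^ (d choose 2) * q ^ (k * l)"
      by (simp flip: power_add)
    have "coeff (qbessel a q k) l =
        1 / ((-1) ^ k * inverse (q ^ (k choose 2)) * qpoch (- a * q ^ k) q k) * (c l * q ^ l)"
      unfolding qbessel_def coeff_smult phi using True by simp
    also have "1 / ((-1) ^ k * inverse (q ^ (k choose 2)) * qpoch (- a * q ^ k) q k)
        = (-1) ^ k * q ^ (k choose 2) / qpoch (- a * q ^ k) q k"
      by (cases "even k") (simp_all add: divide_inverse)
    also have "c l * q ^ l = (-1) ^ l * q ^ (l choose 2) * q ^ l * qbin q k l / q ^ (k * l) * qpoch (- a * q ^ k) q l"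
      using nz(2) by (simp add: c_def 0 qpoch_inverse_power[OF q0 q1 True])
    also have "(-1) ^ k * q ^ (k choose 2) / qpoch (- a * q ^ k) q k * \<dots>
        = ((-1) ^ k * (-1) ^ l) * (q ^ (k choose 2) * q ^ (l choose 2) * q ^ l) / q ^ (k * l) * qbin q k l
          / qpoch (- a * q ^ (k + l)) q d"
      unfolding split using nz(1) by (simp add: mult_ac)
    also have "\<dots> = (-1) ^ d * q ^ (d choose 2) * qbin q k l / qpoch (- a * q ^ (k + l)) q d"
      unfolding sgn pw using q0 by simp
    finally show ?thesis
      using True by (simp add: d_def)
  qed
qed

text \<open>The claimed moments and the coefficients of the polynomials form mutually inverse
  triangular matrices. Off the diagonal, trinomial revision pulls out \<open>qbin q n l\<close>, and
  what remains is the telescoping sum with \<open>b = - a * q ^ (2 * l)\<close>.\<close>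

lemma qbessel_orthogonality:
  assumes "l \<le> n"
  shows "(\<Sum>k=l..n. qbin q n k / qpoch (- a * q ^ (2 * k + 1)) q (n - k) * coeff (qbessel a q k) l)
    = (if l = n then 1 else 0)"
proof (cases "l = n")
  case True
  then show ?thesis by (simp add: coeff_qbessel binomial_eq_0)
next
  case False
  define M where "M = n - Suc l"
  have n: "n = l + Suc M" using assms False by (simp add: M_def)
  define b where "b = - a * q ^ (2 * l)"
  have b: "1 - b * q ^ i \<noteq> 0" for i
    using aq[of "2 * l + i"] by (simp add: b_def power_add mult.assoc)
  have summand: "qbin q n (l + r) / qpoch (- a * q ^ (2 * (l + r) + 1)) q (n - (l + r)) * coeff (qbessel a q (l + r)) l
      = qbin q n l * ((-1) ^ r * q ^ (r choose 2) * qbin q (Suc M) r * (1 - b * q ^ (2 * r))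
      / qpoch (b * q ^ r) q (Suc (Suc M)))" if "r \<le> Suc M" for r
  proof -
    define s where "s = Suc M - r"
    have s: "n - (l + r) = s" "Suc (Suc M) = r + Suc s"
      using that by (auto simp: s_def n)
    have z: "b * q ^ r = - a * q ^ (l + r + l)" "b * q ^ r * q ^ r = b * q ^ (2 * r)"
      "b * q ^ (2 * r) * q = - a * q ^ (2 * (l + r) + 1)"
      by (simp_all add: b_def power_add mult_2 mult_2_right mult_ac)
    \<comment> \<open>The two denominators of a summand are adjacent ranges of factors with just the
      factor 1 - b q^(2r) missing between them. Inserting it produces the numerator of the
      telescoping summand.\<close>
    have D: "qpoch (b * q ^ r) q (Suc (Suc M)) = qpoch (- a * q ^ (l + r + l)) q r *
        ((1 - b * q ^ (2 * r)) * qpoch (- a * q ^ (2 * (l + r) + 1)) q s)"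
      unfolding s(2) qpoch_add qpoch_Suc_left z(2,3) by (simp only: z(1))
    have "qbin q n (l + r) * qbin q (l + r) l = qbin q n l * qbin q (Suc M) r"
      using qbin_trinomial_revision[OF q1, of l "l + r" n] that by (simp add: n del: qbin.simps)
    then have "qbin q n (l + r) / qpoch (- a * q ^ (2 * (l + r) + 1)) q (n - (l + r)) * coeff (qbessel a q (l + r)) l
      = qbin q n l * ((-1) ^ r * q ^ (r choose 2) * qbin q (Suc M) r) /
        (qpoch (- a * q ^ (l + r + l)) q r * qpoch (- a * q ^ (2 * (l + r) + 1)) q s)"
      by (simp add: coeff_qbessel s(1) mult_ac del: qbin.simps)
    then show ?thesis
      unfolding D using b[of "2 * r"] by (simp del: qbin.simps)
  qed
  have "(\<Sum>k=l..n. qbin q n k / qpoch (- a * q ^ (2 * k + 1)) q (n - k) * coeff (qbessel a q k) l)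
     = (\<Sum>r\<le>Suc M. qbin q n (l + r) / qpoch (- a * q ^ (2 * (l + r) + 1)) q (n - (l + r)) * coeff (qbessel a q (l + r)) l)"
    by (intro sum.reindex_bij_witness[of _ "\<lambda>r. l + r" "\<lambda>k. k - l"]) (auto simp: n)
  also have "\<dots> = qbin q n l * (\<Sum>r\<le>Suc M. (-1) ^ r * q ^ (r choose 2) * qbin q (Suc M) r * (1 - b * q ^ (2 * r))
      / qpoch (b * q ^ r) q (Suc (Suc M)))"
    unfolding sum_distrib_left by (rule sum.cong[OF refl]) (rule summand, simp)
  also have "\<dots> = 0"
    using sum_qbin_telescope[OF b, of "Suc M" M] by (simp add: qbin_eq_0)
  finally show ?thesis using False by simp
qed

lemma monom_eq_sum_qbessel:
  "monom 1 n = (\<Sum>k\<le>n. smult (qbin q n k / qpoch (- a * q ^ (2 * k + 1)) q (n - k)) (qbessel a q k))"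
proof (rule poly_eqI)
  fix l
  let ?c = "\<lambda>k. qbin q n k / qpoch (- a * q ^ (2 * k + 1)) q (n - k)"
  have "coeff (\<Sum>k\<le>n. smult (?c k) (qbessel a q k)) l = (\<Sum>k\<le>n. ?c k * coeff (qbessel a q k) l)"
    by (simp add: coeff_sum)
  also have "\<dots> = (\<Sum>k=l..n. ?c k * coeff (qbessel a q k) l)"
    by (rule sum.mono_neutral_right) (auto simp: coeff_qbessel)
  also have "\<dots> = coeff (monom 1 n) l"
    using qbessel_orthogonality[of l n] by (cases "l \<le> n") auto
  finally show "coeff (monom 1 n) l = coeff (\<Sum>k\<le>n. smult (?c k) (qbessel a q k)) l" ..
qed

text \<open>Linear independence, read off from the leading coefficients from the top degree down; it
  gives the uniqueness needed by the definite description of the moments.\<close>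

lemma sum_smult_qbessel_eq_0:
  assumes "(\<Sum>k\<le>n. smult (d k) (qbessel a q k)) = 0" "k \<le> n"
  shows "d k = 0"
  using assms
proof (induction n)
  case 0
  have "coeff (qbessel a q 0) 0 = 1"
    by (simp add: coeff_qbessel binomial_eq_0)
  then have "qbessel a q 0 \<noteq> 0" by auto
  with 0 show ?case by simp
next
  case (Suc n)
  have "coeff (\<Sum>k\<le>Suc n. smult (d k) (qbessel a q k)) (Suc n) = d (Suc n)"
    by (simp add: coeff_sum coeff_qbessel binomial_eq_0 del: qbin.simps)
  with Suc.prems(1) have "d (Suc n) = 0" by simp
  with Suc show ?case by (cases "k = Suc n") auto
qed

lemma qbessel_mixed_moment_eq:
  assumes "k \<le> n"
  shows "qbessel_mixed_moment a q n k = qbin q n k / qpoch (- a * q ^ (2 * k + 1)) q (n - k)"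
proof -
  \<comment> \<open>The value 0 beyond \<open>n\<close> matches the normalization in the definition
    of the moments and makes \<open>c\<close> unique as a function.\<close>
  define c where "c = (\<lambda>k. if k \<le> n then qbin q n k / qpoch (- a * q ^ (2 * k + 1)) q (n - k) else 0)"
  have c: "monom 1 n = (\<Sum>k\<le>n. smult (c k) (qbessel a q k))"
    unfolding monom_eq_sum_qbessel by (rule sum.cong) (simp_all add: c_def)
  have "qbessel_mixed_moment a q n = c"
    unfolding qbessel_mixed_moment_def
  proof (rule the_equality)
    fix c' assume c': "(\<forall>k>n. c' k = 0) \<and> monom 1 n = (\<Sum>k\<le>n. smult (c' k) (qbessel a q k))"
    then have "(\<Sum>k\<le>n. smult (c' k - c k) (qbessel a q k)) = 0"
      using c by (simp add: smult_diff_left sum_subtractf)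
    then have "c' k - c k = 0" if "k \<le> n" for k
      using sum_smult_qbessel_eq_0[of "\<lambda>k. c' k - c k"] that by blast
    then show "c' = c"
      using c' by (force simp: c_def not_le)
  qed (use c in \<open>simp add: c_def\<close>)
  then show ?thesis using assms by (simp add: c_def)
qed

end

section \<open>South-east paths by their last step\<close>

text \<open>The vertex number \<open>s\<close> from below in column \<open>i\<close>; it is \<open>lh_vertex t i j\<close> for
  \<open>s = t (i + 1) + j\<close>, so that south steps are \<open>s + 1 \<mapsto> s\<close> also across levels.\<close>

definition vtx :: "nat \<Rightarrow> nat \<Rightarrow> nat \<times> real" where
  "vtx i s = (i, real s / real (i + 1))"

lemma vtx_eq_iff [simp]: "vtx i s = vtx i' s' \<longleftrightarrow> i = i' \<and> s = s'"
  by (auto simp: vtx_def)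

lemma fst_vtx [simp]: "fst (vtx i s) = i"
  by (simp add: vtx_def)

lemma lh_vertex_eq_vtx: "lh_vertex t i j = vtx i (t * Suc i + j)"
  by (simp add: lh_vertex_def vtx_def field_simps)

lemma vtx_eq_lh_vertex: "vtx i s = lh_vertex (s div Suc i) i (s mod Suc i)"
  by (simp only: lh_vertex_eq_vtx div_mult_mod_eq)

lemma mod_Suc_le: "s mod Suc i \<le> i"
  using mod_less_divisor[of "Suc i" s] by simp

lemma mult_Suc_add_div_mod:
  assumes "j \<le> i"
  shows "(t * Suc i + j) div Suc i = t" "(t * Suc i + j) mod Suc i = j"
  using assms by (simp_all del: mult_Suc_right)

lemma vtx_in_lh_vertices [simp]: "vtx i s \<in> lh_vertices"
  unfolding lh_vertices_def using mod_Suc_le vtx_eq_lh_vertex by blast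

lemma lh_verticesE:
  assumes "u \<in> lh_vertices"
  obtains i s where "u = vtx i s"
  using assms unfolding lh_vertices_def by (auto simp: lh_vertex_eq_vtx)

lemma south_step_vtx_iff: "south_step u (vtx i s) \<longleftrightarrow> u = vtx i (Suc s)"
proof
  assume "u = vtx i (Suc s)"
  moreover have "vtx i (Suc s) = lh_vertex (s div Suc i) i (s mod Suc i + 1)"
    using div_mult_mod_eq[of s "Suc i"] by (simp add: lh_vertex_eq_vtx del: mult_Suc_right)
  ultimately show "south_step u (vtx i s)"
    unfolding south_step_def using mod_Suc_le vtx_eq_lh_vertex by blast
qed (auto simp: south_step_def lh_vertex_eq_vtx)

lemma east_step_vtx_0 [simp]: "\<not> east_step u (vtx 0 s)"
  by (auto simp: east_step_def lh_vertex_eq_vtx)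

lemma lh_vertex_eq_vtx_iff:
  "j \<le> i \<Longrightarrow> lh_vertex t i j = vtx i' s \<longleftrightarrow> i = i' \<and> t = s div Suc i \<and> j = s mod Suc i"
  using mult_Suc_add_div_mod[of j i t] div_mult_mod_eq[of s "Suc i"]
  by (auto simp: lh_vertex_eq_vtx simp del: mult_Suc_right)

text \<open>An east step keeps the level t and the offset j, while a level of column i has one
  vertex fewer than a level of column i + 1. So the vertex number drops by t.\<close>

lemma vtx_minus_div:
  "vtx i (s - s div Suc (Suc i)) = lh_vertex (s div Suc (Suc i)) i (s mod Suc (Suc i))"
proof -
  have "s - s div Suc (Suc i) = s div Suc (Suc i) * Suc i + s mod Suc (Suc i)"
    using div_mult_mod_eq[of s "Suc (Suc i)"] by (simp only: mult_Suc_right)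
  then show ?thesis by (simp only: lh_vertex_eq_vtx)
qed

text \<open>The offset j = i + 1 occurs in column i + 1 but not in column i, so such a vertex is
  entered only by a south step.\<close>

lemma east_step_vtx_Suc_iff:
  "east_step u (vtx (Suc i) s) \<longleftrightarrow> s mod Suc (Suc i) \<le> i \<and> u = vtx i (s - s div Suc (Suc i))"
proof
  assume "east_step u (vtx (Suc i) s)"
  then obtain t j where *: "j \<le> i" "u = lh_vertex t i j" "vtx (Suc i) s = lh_vertex t (Suc i) j"
    by (auto simp: east_step_def lh_vertex_eq_vtx)
  then have s: "s = t * Suc (Suc i) + j"
    by (simp add: lh_vertex_eq_vtx)
  with *(1) have "s mod Suc (Suc i) = j" "s div Suc (Suc i) = t"
    by (simp_all only: mult_Suc_add_div_mod le_SucI)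
  with * s show "s mod Suc (Suc i) \<le> i \<and> u = vtx i (s - s div Suc (Suc i))"
    by (simp add: lh_vertex_eq_vtx)
next
  assume *: "s mod Suc (Suc i) \<le> i \<and> u = vtx i (s - s div Suc (Suc i))"
  then have "u = lh_vertex (s div Suc (Suc i)) i (s mod Suc (Suc i))"
    by (simp only: vtx_minus_div)
  moreover have "vtx (Suc i) s = lh_vertex (s div Suc (Suc i)) (i + 1) (s mod Suc (Suc i))"
    using vtx_eq_lh_vertex[of "Suc i" s] by simp
  ultimately show "east_step u (vtx (Suc i) s)"
    using * unfolding east_step_def by blast
qed

text \<open>The end point is arbitrary so that removing the last step stays within the
  family.\<close>

definition SE_paths_to :: "nat \<Rightarrow> nat \<times> real \<Rightarrow> (nat \<Rightarrow> nat \<times> real) set" where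
  "SE_paths_to k u = {v. (\<forall>m. v m \<in> lh_vertices)
      \<and> v 0 = u
      \<and> (\<lambda>m. fst (v m)) \<longlonglongrightarrow> k
      \<and> filterlim (\<lambda>m. snd (v m)) at_top sequentially
      \<and> (\<forall>m. south_step (v (Suc m)) (v m) \<or> east_step (v (Suc m)) (v m))}"

lemma SE_paths_eq: "SE_paths k n = SE_paths_to k (vtx n 0)"
  by (simp add: SE_paths_def SE_paths_to_def vtx_def)

text \<open>Since indices run backwards, \<open>case_nat u v\<close> appends the final vertex
  \<open>u\<close>. The limit conditions are invariant under this index shift.\<close>

lemma SE_paths_to_cons_iff:
  "case_nat u v \<in> SE_paths_to k u' \<longleftrightarrow> u = u' \<and> u \<in> lh_vertices \<and>
     (south_step (v 0) u \<or> east_step (v 0) u) \<and> v \<in> SE_paths_to k (v 0)"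
proof -
  have "(\<lambda>m. fst (case_nat u v m)) \<longlonglongrightarrow> k \<longleftrightarrow> (\<lambda>m. fst (v m)) \<longlonglongrightarrow> k"
    using filterlim_sequentially_Suc[of "\<lambda>m. fst (case_nat u v m)" "nhds k"] by simp
  moreover have "filterlim (\<lambda>m. snd (case_nat u v m)) at_top sequentially \<longleftrightarrow>
      filterlim (\<lambda>m. snd (v m)) at_top sequentially"
    using filterlim_sequentially_Suc[of "\<lambda>m. snd (case_nat u v m)" at_top] by simp
  moreover have "(\<forall>m. case_nat u v m \<in> lh_vertices) \<longleftrightarrow> u \<in> lh_vertices \<and> (\<forall>m. v m \<in> lh_vertices)"
    by (metis not0_implies_Suc old.nat.simps(4) old.nat.simps(5))
  moreover have "(\<forall>m. south_step (v m) (case_nat u v m) \<or> east_step (v m) (case_nat u v m)) \<longleftrightarrow>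
      (south_step (v 0) u \<or> east_step (v 0) u) \<and>
      (\<forall>m. south_step (v (Suc m)) (v m) \<or> east_step (v (Suc m)) (v m))"
    by (metis not0_implies_Suc old.nat.simps(4) old.nat.simps(5))
  ultimately show ?thesis
    by (auto simp: SE_paths_to_def)
qed

lemma case_nat_split: "v = case_nat (v 0) (\<lambda>m. v (Suc m))"
  by (auto split: nat.split)

lemma SE_paths_to_start: "v \<in> SE_paths_to k u \<Longrightarrow> v 0 = u"
  by (simp add: SE_paths_to_def)

lemma case_nat_mem_SE_paths_to:
  assumes "v \<in> SE_paths_to k u'" "south_step u' (vtx i s) \<or> east_step u' (vtx i s)"
  shows "case_nat (vtx i s) v \<in> SE_paths_to k (vtx i s)"
  using assms SE_paths_to_start[OF assms(1)] by (simp add: SE_paths_to_cons_iff)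

lemma SE_paths_to_cases:
  assumes "v \<in> SE_paths_to k (vtx i s)"
  obtains (south) v' where "v = case_nat (vtx i s) v'" "v' \<in> SE_paths_to k (vtx i (Suc s))"
  | (east) i' v' where "i = Suc i'" "s mod Suc (Suc i') \<le> i'" "v = case_nat (vtx i s) v'"
      "v' \<in> SE_paths_to k (vtx i' (s - s div Suc (Suc i')))"
proof -
  define v' where "v' = (\<lambda>m. v (Suc m))"
  have v: "v = case_nat (vtx i s) v'"
    using case_nat_split[of v] SE_paths_to_start[OF assms] by (simp add: v'_def)
  have *: "south_step (v' 0) (vtx i s) \<or> east_step (v' 0) (vtx i s)" "v' \<in> SE_paths_to k (v' 0)"
    using assms unfolding v by (simp_all add: SE_paths_to_cons_iff)
  show thesis
  proof (cases "south_step (v' 0) (vtx i s)")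
    case True
    then show thesis
      using south v *(2) by (simp add: south_step_vtx_iff)
  next
    case False
    then have e: "east_step (v' 0) (vtx i s)"
      using * by simp
    then obtain i' where "i = Suc i'"
      by (cases i) auto
    with e show thesis
      using east v *(2) by (simp add: east_step_vtx_Suc_iff)
  qed
qed

lemma SE_paths_to_Suc:
  "SE_paths_to k (vtx (Suc i) s) = case_nat (vtx (Suc i) s) ` SE_paths_to k (vtx (Suc i) (Suc s)) \<union>
     (if s mod Suc (Suc i) \<le> i
      then case_nat (vtx (Suc i) s) ` SE_paths_to k (vtx i (s - s div Suc (Suc i))) else {})"
proof (intro equalityI subsetI)
  fix v assume "v \<in> SE_paths_to k (vtx (Suc i) s)"
  then show "v \<in> case_nat (vtx (Suc i) s) ` SE_paths_to k (vtx (Suc i) (Suc s)) \<union>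
     (if s mod Suc (Suc i) \<le> i
      then case_nat (vtx (Suc i) s) ` SE_paths_to k (vtx i (s - s div Suc (Suc i))) else {})"
    by (cases rule: SE_paths_to_cases) auto
qed (auto simp: south_step_vtx_iff east_step_vtx_Suc_iff split: if_splits
      intro!: case_nat_mem_SE_paths_to)

section \<open>The columns visited by a path\<close>

lemma SE_paths_to_step_vtx:
  assumes "v \<in> SE_paths_to k u"
  shows "south_step (v (Suc m)) (v m) \<or> east_step (v (Suc m)) (v m)" "\<exists>i s. v m = vtx i s"
  using assms unfolding SE_paths_to_def by (blast elim: lh_verticesE)+

lemma SE_paths_to_fst_mono:
  assumes "v \<in> SE_paths_to k u"
  shows "antimono (\<lambda>m. fst (v m))"
proof (rule decseq_SucI)
  fix m
  from SE_paths_to_step_vtx(1)[OF assms, of m] show "fst (v (Suc m)) \<le> fst (v m)"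
    by (auto simp: south_step_def east_step_def lh_vertex_eq_vtx)
qed

lemma SE_paths_to_eventually_fst:
  assumes "v \<in> SE_paths_to k u"
  obtains M where "\<And>m. m \<ge> M \<Longrightarrow> fst (v m) = k"
proof -
  have "eventually (\<lambda>m. fst (v m) = k) sequentially"
    using assms by (simp add: SE_paths_to_def tendsto_discrete)
  then show thesis
    using that by (auto simp: eventually_sequentially)
qed

lemma SE_paths_to_fst_ge:
  assumes "v \<in> SE_paths_to k u"
  shows "k \<le> fst (v m)"
proof -
  obtain M where M: "\<And>m. m \<ge> M \<Longrightarrow> fst (v m) = k"
    using SE_paths_to_eventually_fst[OF assms] by blast
  show ?thesis
    using antimonoD[OF SE_paths_to_fst_mono[OF assms], of m "max m M"] M[of "max m M"] by simp
qed

lemma SE_paths_to_empty: "i < k \<Longrightarrow> SE_paths_to k (vtx i s) = {}"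
  using SE_paths_to_fst_ge[of _ k "vtx i s" 0] SE_paths_to_start[of _ k "vtx i s"] by fastforce

text \<open>A path never visits a column left of its limit column \<open>k\<close>, so one that ends
  in column \<open>k\<close> has only south steps.\<close>

lemma SE_paths_to_vertical: "SE_paths_to k (vtx k s) = {\<lambda>m. vtx k (s + m)}"
proof (intro equalityI subsetI)
  fix v assume v: "v \<in> SE_paths_to k (vtx k s)"
  have "v m = vtx k (s + m)" for m
  proof (induction m)
    case 0
    then show ?case using SE_paths_to_start[OF v] by simp
  next
    case (Suc m)
    have "\<not> east_step (v (Suc m)) (v m)"
    proof
      assume "east_step (v (Suc m)) (v m)"
      then have "fst (v (Suc m)) < fst (v m)"
        by (auto simp: east_step_def lh_vertex_eq_vtx)
      with Suc SE_paths_to_fst_ge[OF v, of "Suc m"] show False by simp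
    qed
    with SE_paths_to_step_vtx(1)[OF v, of m] Suc show ?case
      by (simp add: south_step_vtx_iff)
  qed
  then show "v \<in> {\<lambda>m. vtx k (s + m)}" by auto
next
  fix v assume "v \<in> {\<lambda>m. vtx k (s + m)}"
  then have v: "v = (\<lambda>m. vtx k (s + m))" by simp
  have "filterlim (\<lambda>m. real (s + m) * inverse (real (k + 1))) at_top sequentially"
    by (intro filterlim_at_top_mult_tendsto_pos[OF tendsto_const]
        filterlim_compose[OF filterlim_real_sequentially]
        filterlim_add_const_nat_at_top)
       (auto simp: add.commute filterlim_add_const_nat_at_top)
  then show "v \<in> SE_paths_to k (vtx k s)"
    unfolding SE_paths_to_def v
    by (simp add: south_step_vtx_iff) (simp add: vtx_def divide_inverse)
qed

section \<open>East steps and the weight of an extended path\<close>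

definition east_steps :: "(nat \<Rightarrow> nat \<times> real) \<Rightarrow> (nat \<times> nat \<times> nat) set" where
  "east_steps v = {(t, i, j). j \<le> i \<and> (\<exists>m. v (Suc m) = lh_vertex t i j \<and> v m = lh_vertex t (i + 1) j)}"

lemma path_weight_eq: "path_weight w v = (\<Prod>(t, i, j) \<in> east_steps v. w t i j)"
  by (simp add: path_weight_def east_steps_def)

text \<open>Columns form a discrete space, so the path is eventually in column \<open>k\<close>, and
  each index contributes at most one triple. Finiteness matters because a product over an infinite
  set defaults to 1.\<close>

lemma finite_east_steps:
  assumes "v \<in> SE_paths_to k u"
  shows "finite (east_steps v)"
proof -
  obtain M where M: "\<And>m. m \<ge> M \<Longrightarrow> fst (v m) = k"
    using SE_paths_to_eventually_fst[OF assms] by blast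
  have "m < M" if "v (Suc m) = lh_vertex t i j" "v m = lh_vertex t (i + 1) j" for m t i j
    using M[of m] M[of "Suc m"] that by (cases "m < M") (auto simp: lh_vertex_eq_vtx)
  then have "east_steps v \<subseteq> (\<Union>m<M. {(t, i, j). j \<le> i \<and> v (Suc m) = lh_vertex t i j})"
    by (fastforce simp: east_steps_def)
  moreover have "finite {(t, i, j). j \<le> i \<and> v (Suc m) = lh_vertex t i j}" for m
  proof -
    obtain i s where "v (Suc m) = vtx i s"
      using SE_paths_to_step_vtx(2)[OF assms] by blast
    then have "i' = i \<and> t = s div Suc i \<and> j = s mod Suc i"
      if "j \<le> i'" "v (Suc m) = lh_vertex t i' j" for t i' j
      using that lh_vertex_eq_vtx_iff[of j i' t i s] by auto
    then have "{(t, i, j). j \<le> i \<and> v (Suc m) = lh_vertex t i j} \<subseteq> {(s div Suc i, i, s mod Suc i)}"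
      by blast
    then show ?thesis using finite_subset by blast
  qed
  ultimately show ?thesis
    using finite_subset by blast
qed

lemma east_steps_cons:
  "east_steps (case_nat u v) = east_steps v \<union>
     {(t, i, j). j \<le> i \<and> v 0 = lh_vertex t i j \<and> u = lh_vertex t (i + 1) j}"
proof -
  have "(\<exists>m. P (v m) (case_nat u v m)) \<longleftrightarrow> P (v 0) u \<or> (\<exists>m. P (v (Suc m)) (v m))" for P
    by (metis not0_implies_Suc old.nat.simps(4) old.nat.simps(5))
  from this[of "\<lambda>x y. x = lh_vertex _ _ _ \<and> y = lh_vertex _ _ _"]
  show ?thesis by (auto simp: east_steps_def)
qed

lemma path_weight_south:
  assumes "v \<in> SE_paths_to k (vtx i (Suc s))"
  shows "path_weight w (case_nat (vtx i s) v) = path_weight w v"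
proof -
  have "east_steps (case_nat (vtx i s) v) = east_steps v"
    using SE_paths_to_start[OF assms] by (auto simp: east_steps_cons lh_vertex_eq_vtx)
  then show ?thesis by (simp add: path_weight_eq)
qed

lemma path_weight_east:
  assumes v: "v \<in> SE_paths_to k (vtx i (s - s div Suc (Suc i)))" and s: "s mod Suc (Suc i) \<le> i"
  shows "path_weight w (case_nat (vtx (Suc i) s) v) = w (s div Suc (Suc i)) i (s mod Suc (Suc i)) * path_weight w v"
proof -
  let ?e = "(s div Suc (Suc i), i, s mod Suc (Suc i))"
  have "{(t, i', j). j \<le> i' \<and> v 0 = lh_vertex t i' j \<and> vtx (Suc i) s = lh_vertex t (i' + 1) j} = {?e}"
  proof -
    have "v 0 = lh_vertex (s div Suc (Suc i)) i (s mod Suc (Suc i))"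
      using SE_paths_to_start[OF v] by (simp only: vtx_minus_div)
    moreover have "vtx (Suc i) s = lh_vertex (s div Suc (Suc i)) (i + 1) (s mod Suc (Suc i))"
      using vtx_eq_lh_vertex[of "Suc i" s] by simp
    moreover have "t = s div Suc (Suc i) \<and> i' = i \<and> j = s mod Suc (Suc i)"
      if "j \<le> i'" "vtx (Suc i) s = lh_vertex t (i' + 1) j" for t i' j
      using that lh_vertex_eq_vtx_iff[of j "i' + 1" t "Suc i" s] by simp
    ultimately show ?thesis using s by blast
  qed
  then have "east_steps (case_nat (vtx (Suc i) s) v) = insert ?e (east_steps v)"
    by (simp add: east_steps_cons)
  \<comment> \<open>The path \<open>v\<close> stays in columns up to \<open>i\<close>, whereas this
    step ends in column i + 1.\<close>
  moreover have "?e \<notin> east_steps v"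
  proof
    assume "?e \<in> east_steps v"
    then obtain m where "v m = lh_vertex (s div Suc (Suc i)) (i + 1) (s mod Suc (Suc i))"
      by (auto simp: east_steps_def)
    then have "fst (v m) = Suc i"
      by (simp add: lh_vertex_def)
    then show False
      using antimonoD[OF SE_paths_to_fst_mono[OF v], of 0 m] SE_paths_to_start[OF v] by simp
  qed
  ultimately show ?thesis
    using finite_east_steps[OF v] by (simp add: path_weight_eq)
qed

section \<open>Generating functions of paths\<close>

definition moment_fps :: "'a::field fps \<Rightarrow> 'a fps \<Rightarrow> nat \<Rightarrow> nat \<Rightarrow> 'a fps" where
  "moment_fps a q n k = qbin q n k * inverse (qpoch (- a * q ^ (2 * k + 1)) q (n - k))"

text \<open>Moving a path from \<open>(k, \<infinity>)\<close> to column \<open>m\<close> up by one level multiplies its weight by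
  \<open>\<Prod>i=k..<m. - a * q ^ (2 * i + 1)\<close>, which is the following product for \<open>k \<le> m\<close>.\<close>

definition level_factor :: "'a::comm_ring_1 \<Rightarrow> 'a \<Rightarrow> nat \<Rightarrow> nat \<Rightarrow> 'a" where
  "level_factor a q k m = (- a * q ^ (2 * k + 1)) ^ (m - k) * q ^ ((m - k) * (m - k - 1))"

text \<open>Paths to \<open>lh_vertex 0 i j\<close>, sorted by the column \<open>m\<close> in which they reach height 1;
  \<open>path_gf\<close> is the generating function of the paths to \<open>vtx i s\<close>.\<close>

definition level_sum :: "'a::field fps \<Rightarrow> 'a fps \<Rightarrow> nat \<Rightarrow> nat \<Rightarrow> nat \<Rightarrow> 'a fps" where
  "level_sum a q k i j =
     (\<Sum>m\<le>i. q ^ (j * (i - m)) * qbin q (i - j) (i - m) * (level_factor a q k m * moment_fps a q m k))"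

definition path_gf :: "'a::field fps \<Rightarrow> 'a fps \<Rightarrow> nat \<Rightarrow> nat \<Rightarrow> nat \<Rightarrow> 'a fps" where
  "path_gf a q k i s = level_factor a q k i ^ (s div Suc i) * level_sum a q k i (s mod Suc i)"

lemma moment_fps_eq_0: "n < k \<Longrightarrow> moment_fps a q n k = 0"
  by (simp add: moment_fps_def qbin_eq_0)

lemma moment_fps_self [simp]: "moment_fps a q k k = 1"
  by (simp add: moment_fps_def)

lemma level_factor_self [simp]: "level_factor a q k k = 1"
  by (simp add: level_factor_def)

lemma level_factor_Suc:
  assumes "k \<le> i"
  shows "level_factor a q k (Suc i) = - a * q ^ (2 * i + 1) * level_factor a q k i"
proof -
  define d where "d = i - k"
  have i: "i = k + d" using assms by (simp add: d_def)
  define z where "z = - a * q ^ (2 * k + 1)"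
  have e: "q ^ (Suc d * (Suc d - 1)) = q ^ (2 * d) * q ^ (d * (d - 1))"
  proof -
    have "Suc d * (Suc d - 1) = 2 * d + d * (d - 1)"
      by (cases d) simp_all
    then show ?thesis by (simp only: power_add)
  qed
  have z: "- a * q ^ (2 * i + 1) = z * q ^ (2 * d)"
    by (simp add: z_def i power_add algebra_simps)
  have d: "Suc i - k = Suc d" "i - k = d"
    by (simp_all add: i)
  show ?thesis
    unfolding level_factor_def z_def[symmetric] z d e by (simp add: mult_ac)
qed

lemma level_sum_eq_0: "i < k \<Longrightarrow> level_sum a q k i j = 0"
  by (simp add: level_sum_def moment_fps_eq_0)

text \<open>At the top vertex of the lowest level, \<open>j = i\<close>, height 1 can only have been
  reached in the same column; correspondingly all terms with m < i vanish.\<close>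

lemma level_sum_ge:
  assumes "i \<le> j"
  shows "level_sum a q k i j = level_factor a q k i * moment_fps a q i k"
proof -
  have "level_sum a q k i j = (\<Sum>m\<in>{i}. q ^ (j * (i - m)) * qbin q (i - j) (i - m) *
      (level_factor a q k m * moment_fps a q m k))"
    unfolding level_sum_def using assms by (intro sum.mono_neutral_right) (auto simp: qbin_eq_0)
  then show ?thesis using assms by simp
qed

lemma level_sum_self [simp]: "level_sum a q k k j = 1"
proof -
  have "level_sum a q k k j = (\<Sum>m\<in>{k}. q ^ (j * (k - m)) * qbin q (k - j) (k - m) *
      (level_factor a q k m * moment_fps a q m k))"
    unfolding level_sum_def by (intro sum.mono_neutral_right) (auto simp: moment_fps_eq_0)
  then show ?thesis by simp
qed

text \<open>Removal of the last step within the lowest level, termwise Pascal's recurrence. The term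
  m = i + 1 is common to both sums over column i + 1.\<close>

lemma level_sum_Suc:
  assumes "j \<le> i"
  shows "level_sum a q k (Suc i) j = level_sum a q k (Suc i) (Suc j) + q ^ j * level_sum a q k i j"
proof -
  let ?g = "\<lambda>m. level_factor a q k m * moment_fps a q m k"
  have "q ^ (j * (Suc i - m)) * qbin q (Suc i - j) (Suc i - m) * ?g m
      = q ^ (Suc j * (Suc i - m)) * qbin q (Suc i - Suc j) (Suc i - m) * ?g m
        + q ^ j * (q ^ (j * (i - m)) * qbin q (i - j) (i - m) * ?g m)" if "m \<le> i" for m
  proof -
    define r d where "r = i - m" "d = i - j"
    with that assms have "Suc i - m = Suc r" "Suc i - j = Suc d" "Suc i - Suc j = d" "i - m = r" "i - j = d"
      by auto
    then show ?thesis
      by (simp add: power_add algebra_simps)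
  qed
  then have "(\<Sum>m\<le>i. q ^ (j * (Suc i - m)) * qbin q (Suc i - j) (Suc i - m) * ?g m)
      = (\<Sum>m\<le>i. q ^ (Suc j * (Suc i - m)) * qbin q (Suc i - Suc j) (Suc i - m) * ?g m)
        + q ^ j * level_sum a q k i j"
    by (simp add: level_sum_def sum.distrib sum_distrib_left)
  then show ?thesis
    by (simp add: level_sum_def)
qed

text \<open>At height 0 the sum over crossing columns must reproduce the closed form. Trinomial
  revision extracts \<open>qbin q i k\<close> and leaves the Durfee-type sum in z = -a
  q^(2k+1).\<close>

lemma level_sum_0:
  assumes a: "a $ 0 = 0" and q: "\<And>i. 0 < i \<Longrightarrow> q ^ i \<noteq> 1"
  shows "level_sum a q k i 0 = moment_fps a q i k"
proof (cases "k \<le> i")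
  case False
  then show ?thesis by (simp add: level_sum_eq_0 moment_fps_eq_0)
next
  case True
  define z where "z = - a * q ^ (2 * k + 1)"
  have z: "z $ 0 = 0" using a by (simp add: z_def)
  have "level_sum a q k i 0 = (\<Sum>m=k..i. qbin q i (i - m) * (level_factor a q k m * moment_fps a q m k))"
    unfolding level_sum_def by (simp, intro sum.mono_neutral_right) (auto simp: moment_fps_eq_0)
  also have "\<dots> = (\<Sum>m=k..i. qbin q i k * (qbin q (i - k) (m - k) *
      (z ^ (m - k) * q ^ ((m - k) * (m - k - 1)) * inverse (qpoch z q (m - k)))))"
  proof (rule sum.cong[OF refl])
    fix m assume "m \<in> {k..i}"
    then have "k \<le> m" "m \<le> i" by auto
    then have h: "qbin q i (i - m) * qbin q m k = qbin q i k * qbin q (i - k) (m - k)"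
      using qbin_trinomial_revision[OF q] by (simp add: qbin_symmetric)
    have "qbin q i (i - m) * (level_factor a q k m * moment_fps a q m k) = (qbin q i (i - m) * qbin q m k) *
        (z ^ (m - k) * q ^ ((m - k) * (m - k - 1)) * inverse (qpoch z q (m - k)))"
      unfolding level_factor_def moment_fps_def z_def[symmetric] by (simp only: mult_ac)
    then show "qbin q i (i - m) * (level_factor a q k m * moment_fps a q m k) =
        qbin q i k * (qbin q (i - k) (m - k) *
          (z ^ (m - k) * q ^ ((m - k) * (m - k - 1)) * inverse (qpoch z q (m - k))))"
      by (simp only: h mult.assoc)
  qed
  also have "\<dots> = (\<Sum>r\<le>i - k. qbin q i k * (qbin q (i - k) r *
      (z ^ r * q ^ (r * (r - 1)) * inverse (qpoch z q r))))"
    using True by (intro sum.reindex_bij_witness[of _ "\<lambda>r. r + k" "\<lambda>m. m - k"]) auto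
  also have "\<dots> = qbin q i k * inverse (qpoch z q (i - k))"
    by (simp only: durfee_identity[OF z] flip: sum_distrib_left)
  finally show ?thesis by (simp add: moment_fps_def z_def)
qed

section \<open>Generating functions at arbitrary end points\<close>

lemma path_gf_eq_0: "i < k \<Longrightarrow> path_gf a q k i s = 0"
  by (simp add: path_gf_def level_sum_eq_0)

lemma path_gf_self [simp]: "path_gf a q k k s = 1"
  by (simp add: path_gf_def)

lemma path_gf_add:
  "j \<le> i \<Longrightarrow> path_gf a q k i (t * Suc i + j) = level_factor a q k i ^ t * level_sum a q k i j"
  by (simp add: path_gf_def del: mult_Suc_right)

text \<open>Inside a level this is \<open>level_sum_Suc\<close>: the east step at level t has weight
  (-a q^(2i+1))^t q^j, whose first factor is exactly what turns the level factor of column i into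
  that of column i + 1.\<close>

lemma path_gf_Suc:
  assumes a: "a $ 0 = 0" and q: "\<And>i. 0 < i \<Longrightarrow> q ^ i \<noteq> 1" and "k \<le> i"
  shows "path_gf a q k (Suc i) s = path_gf a q k (Suc i) (Suc s) +
     (if s mod Suc (Suc i) \<le> i
      then qbessel_weight a q (s div Suc (Suc i)) i (s mod Suc (Suc i)) *
        path_gf a q k i (s - s div Suc (Suc i)) else 0)"
proof -
  define t j where tj: "t = s div Suc (Suc i)" "j = s mod Suc (Suc i)"
  have s: "s = t * Suc (Suc i) + j"
    by (simp only: tj div_mult_mod_eq)
  have "j < Suc (Suc i)" unfolding tj by (rule mod_less_divisor) simp
  then have j: "j \<le> Suc i" by simp
  have 1: "path_gf a q k (Suc i) s = level_factor a q k (Suc i) ^ t * level_sum a q k (Suc i) j"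
    using path_gf_add[OF j] s by metis
  show ?thesis
  proof (cases "j \<le> i")
    case True
    have "path_gf a q k (Suc i) (Suc s) = path_gf a q k (Suc i) (t * Suc (Suc i) + Suc j)"
      using s by simp
    also have "\<dots> = level_factor a q k (Suc i) ^ t * level_sum a q k (Suc i) (Suc j)"
      using True by (intro path_gf_add) simp
    finally have 2: "path_gf a q k (Suc i) (Suc s) = \<dots>" .
    have "s - t = t * Suc i + j"
      using s by simp
    then have 3: "path_gf a q k i (s - t) = level_factor a q k i ^ t * level_sum a q k i j"
      using path_gf_add[OF True] by metis
    have "level_factor a q k (Suc i) ^ t = (- a * q ^ (2 * i + 1)) ^ t * level_factor a q k i ^ t"
      by (simp only: level_factor_Suc[OF \<open>k \<le> i\<close>] power_mult_distrib)
    then show ?thesis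
      unfolding tj[symmetric] 1 2 3 level_sum_Suc[OF True] qbessel_weight_def
      using True by (simp only: distrib_left mult_ac if_True)
  next
    case False
    then have j: "j = Suc i" using j by simp
    \<comment> \<open>At the top offset the south step crosses into the next level, where the offset
      restarts at 0; \<open>level_sum_0\<close> and \<open>level_sum_ge\<close> make the two values
      agree.\<close>
    have "path_gf a q k (Suc i) (Suc s) = path_gf a q k (Suc i) (Suc t * Suc (Suc i) + 0)"
      using s j by (simp add: algebra_simps)
    also have "\<dots> = level_factor a q k (Suc i) ^ Suc t * level_sum a q k (Suc i) 0"
      by (intro path_gf_add) simp
    finally show ?thesis
      unfolding tj[symmetric] 1 j
      by (simp add: level_sum_0[OF a q] level_sum_ge)
  qed
qed

lemma path_gf_dvd:
  assumes "k < i"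
  shows "a ^ (s div Suc i) dvd path_gf a q k i s"
proof -
  have "a dvd (- a * q ^ (2 * k + 1)) ^ (i - k)"
    using assms by (intro dvd_trans[OF _ dvd_power[of "i - k"]]) auto
  then have "a dvd level_factor a q k i"
    unfolding level_factor_def by (rule dvd_mult2)
  then show ?thesis
    unfolding path_gf_def by (intro dvd_mult2 dvd_power_same)
qed

section \<open>Summation over paths\<close>

text \<open>Fixing the degree \<open>d\<close> makes the downward induction on the height of the end point finite.\<close>

definition sums_upto :: "nat \<Rightarrow> ('b \<Rightarrow> 'a::comm_ring_1 fps) \<Rightarrow> 'b set \<Rightarrow> 'a fps \<Rightarrow> bool" where
  "sums_upto d f S g \<longleftrightarrow> (\<forall>e\<le>d. finite {x \<in> S. f x $ e \<noteq> 0} \<and> (\<Sum>x | x \<in> S \<and> f x $ e \<noteq> 0. f x $ e) = g $ e)"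

text \<open>Convergence of power series is coefficientwise, so finite support in every degree
  suffices.\<close>

lemma has_sum_of_sums_upto:
  assumes "\<And>d. sums_upto d f S g"
  shows "(f has_sum g) S"
  using assms unfolding sums_upto_def by (intro has_sum_fpsI) (blast, metis order_refl)

lemma sums_upto_empty [simp]: "sums_upto d f {} 0"
  by (simp add: sums_upto_def)

lemma sums_upto_singleton: "sums_upto d f {x} (f x)"
proof -
  have "{y. y = x \<and> f y $ e \<noteq> 0} = (if f x $ e = 0 then {} else {x})" for e
    by auto
  then show ?thesis by (auto simp: sums_upto_def)
qed

lemma sums_upto_Un:
  assumes "sums_upto d f A g" "sums_upto d f B h" "A \<inter> B = {}"
  shows "sums_upto d f (A \<union> B) (g + h)"
proof -
  have "{x \<in> A \<union> B. f x $ e \<noteq> 0} = {x \<in> A. f x $ e \<noteq> 0} \<union> {x \<in> B. f x $ e \<noteq> 0}" for e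
    by auto
  moreover have "{x \<in> A. f x $ e \<noteq> 0} \<inter> {x \<in> B. f x $ e \<noteq> 0} = {}" for e
    using assms(3) by auto
  ultimately show ?thesis
    using assms(1,2) by (simp add: sums_upto_def sum.union_disjoint)
qed

lemma sums_upto_image:
  assumes "sums_upto d (\<lambda>x. f (h x)) A g" "inj_on h A"
  shows "sums_upto d f (h ` A) g"
proof -
  have "{y \<in> h ` A. f y $ e \<noteq> 0} = h ` {x \<in> A. f (h x) $ e \<noteq> 0}" for e
    by auto
  moreover have "inj_on h {x \<in> A. f (h x) $ e \<noteq> 0}" for e
    using assms(2) by (rule inj_on_subset) auto
  ultimately show ?thesis
    using assms(1) by (simp add: sums_upto_def sum.reindex)
qed

lemma sums_upto_cong:
  assumes "\<And>x. x \<in> A \<Longrightarrow> f x = f' x"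
  shows "sums_upto d f A g \<longleftrightarrow> sums_upto d f' A g"
proof -
  have "{x \<in> A. f x $ e \<noteq> 0} = {x \<in> A. f' x $ e \<noteq> 0}" for e
    using assms by auto
  then show ?thesis
    using assms by (simp add: sums_upto_def)
qed

lemma sums_upto_mult:
  assumes "sums_upto d f A g"
  shows "sums_upto d (\<lambda>x. c * f x) A (c * g)"
  unfolding sums_upto_def
proof (intro allI impI)
  fix e assume e: "e \<le> d"
  \<comment> \<open>Coefficient \<open>e\<close> of a product involves only coefficients up to
    \<open>e\<close> of its factors, so this finite set contains all relevant indices.\<close>
  define T where "T = (\<Union>i\<le>e. {x \<in> A. f x $ i \<noteq> 0})"
  have T: "finite T" "T \<subseteq> A"
    using assms e by (auto simp: T_def sums_upto_def)
  have g: "(\<Sum>x\<in>T. f x $ i) = g $ i" if "i \<le> e" for i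
  proof -
    have "(\<Sum>x\<in>T. f x $ i) = (\<Sum>x | x \<in> A \<and> f x $ i \<noteq> 0. f x $ i)"
      using T that by (intro sum.mono_neutral_right) (auto simp: T_def)
    then show ?thesis using assms e that by (simp add: sums_upto_def)
  qed
  have sub: "{x \<in> A. (c * f x) $ e \<noteq> 0} \<subseteq> T"
  proof
    fix x assume "x \<in> {x \<in> A. (c * f x) $ e \<noteq> 0}"
    then have x: "x \<in> A" "(\<Sum>i=0..e. c $ i * f x $ (e - i)) \<noteq> 0"
      by (auto simp: fps_mult_nth)
    then obtain i where "i \<le> e" "c $ i * f x $ (e - i) \<noteq> 0"
      by (metis (no_types, lifting) atLeastAtMost_iff sum.neutral)
    then show "x \<in> T"
      using x(1) unfolding T_def by (intro UN_I[of "e - i"]) auto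
  qed
  have "(\<Sum>x | x \<in> A \<and> (c * f x) $ e \<noteq> 0. (c * f x) $ e) = (\<Sum>x\<in>T. (c * f x) $ e)"
    using T sub by (intro sum.mono_neutral_left) auto
  also have "\<dots> = (\<Sum>x\<in>T. \<Sum>i=0..e. c $ i * f x $ (e - i))"
    by (simp add: fps_mult_nth)
  also have "\<dots> = (\<Sum>i=0..e. c $ i * (\<Sum>x\<in>T. f x $ (e - i)))"
    by (subst sum.swap) (simp add: sum_distrib_left)
  also have "\<dots> = (c * g) $ e"
    by (simp add: fps_mult_nth g)
  finally show "finite {x \<in> A. (c * f x) $ e \<noteq> 0} \<and>
      (\<Sum>x | x \<in> A \<and> (c * f x) $ e \<noteq> 0. (c * f x) $ e) = (c * g) $ e"
    using finite_subset[OF sub] T by simp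
qed

lemma sums_upto_0:
  assumes "\<And>x e. x \<in> A \<Longrightarrow> e \<le> d \<Longrightarrow> f x $ e = 0" "\<And>e. e \<le> d \<Longrightarrow> g $ e = 0"
  shows "sums_upto d f A g"
proof -
  have *: "{x \<in> A. f x $ e \<noteq> 0} = {}" if "e \<le> d" for e
    using assms(1) that by auto
  show ?thesis
    by (simp add: sums_upto_def * assms(2))
qed

lemma fps_X_power_dvd_nth: "fps_X ^ n dvd f \<Longrightarrow> e < n \<Longrightarrow> f $ e = 0"
  for f :: "'a::comm_ring_1 fps"
  by (auto simp: fps_X_power_mult_nth)

text \<open>Traced back from its end, the path climbs until its first east step, which lies at level
  at least \<open>s div Suc i\<close> and contributes that many factors \<open>a\<close>. The
  induction is on an index \<open>M\<close> at which column \<open>k\<close> has been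
  reached.\<close>

lemma path_weight_dvd:
  assumes "v \<in> SE_paths_to k (vtx i s)" "k < i"
  shows "a ^ (s div Suc i) dvd path_weight (qbessel_weight a q) v"
proof -
  obtain M where M: "fst (v M) = k"
    using SE_paths_to_eventually_fst[OF assms(1)] by blast
  from this assms show ?thesis
  proof (induction M arbitrary: v i s)
    case 0
    then show ?case using SE_paths_to_start[of v k "vtx i s"] by simp
  next
    case (Suc M)
    from Suc.prems(2) show ?case
    proof (cases rule: SE_paths_to_cases)
      case (south v')
      then have "a ^ (Suc s div Suc i) dvd path_weight (qbessel_weight a q) v"
        using Suc.IH[of v' i "Suc s"] Suc.prems by (simp add: path_weight_south)
      moreover have "a ^ (s div Suc i) dvd a ^ (Suc s div Suc i)"
        by (intro le_imp_power_dvd div_le_mono) simp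
      ultimately show ?thesis by (rule dvd_trans[rotated])
    next
      case (east i' v')
      have "a ^ t dvd qbessel_weight a q t i' j" for t j
        unfolding qbessel_weight_def by (intro dvd_mult2 dvd_power_same) simp
      then show ?thesis
        using east by (simp add: path_weight_east)
    qed
  qed
qed

lemma inj_on_case_nat: "inj_on (case_nat u) A"
  by (rule inj_onI) (metis ext old.nat.simps(5))

text \<open>Outer induction on the column, inner induction downwards on the height; both sides
  satisfy the same last-step recurrence.\<close>

lemma sums_upto_paths:
  fixes q :: "'a::field fps"
  assumes q: "\<And>i. 0 < i \<Longrightarrow> q ^ i \<noteq> 1"
  shows "sums_upto d (path_weight (qbessel_weight fps_X q)) (SE_paths_to k (vtx i s)) (path_gf fps_X q k i s)"
proof (induction i arbitrary: s rule: less_induct)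
  case (less i)
  consider "i < k" | "i = k" | i' where "i = Suc i'" "k \<le> i'"
    by (cases i) (auto simp: not_less_eq_eq le_less_linear intro: that, metis linorder_not_le not_less_eq_eq le_antisym)
  then show ?case
  proof cases
    case 1
    then show ?thesis by (simp add: SE_paths_to_empty path_gf_eq_0)
  next
    case 2
    have "east_steps (\<lambda>m. vtx k (s + m)) = {}"
      by (auto simp: east_steps_def lh_vertex_eq_vtx)
    then have "path_weight (qbessel_weight fps_X q) (\<lambda>m. vtx k (s + m)) = 1"
      by (simp add: path_weight_eq)
    then show ?thesis
      using sums_upto_singleton[of d "path_weight (qbessel_weight fps_X q)" "\<lambda>m. vtx k (s + m)"] 2
      by (simp add: SE_paths_to_vertical)
  next
    case (3 i')
    \<comment> \<open>\<open>r\<close> counts the vertices still missing up to height d + 1. From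
      there on, weights and generating function are divisible by the power d + 1 of the variable, so
      both vanish through degree \<open>d\<close>.\<close>
    define r where "r = Suc d * Suc i - s"
    then have "Suc d * Suc i \<le> s + r" by simp
    then show ?thesis
    proof (induction r arbitrary: s)
      case 0
      then have "Suc d * Suc i div Suc i \<le> s div Suc i"
        by (intro div_le_mono) simp
      then have d: "d < s div Suc i"
        by (simp only: nonzero_mult_div_cancel_right)
      show ?case
      proof (rule sums_upto_0)
        fix v e assume "v \<in> SE_paths_to k (vtx i s)" "e \<le> d"
        then show "path_weight (qbessel_weight fps_X q) v $ e = 0"
          using d 3 by (intro fps_X_power_dvd_nth[OF path_weight_dvd[of v k i s]]) auto
      next
        fix e assume "e \<le> d"
        then show "path_gf fps_X q k i s $ e = 0"
          using d 3 by (intro fps_X_power_dvd_nth[OF path_gf_dvd[of k i]]) auto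
      qed
    next
      case (Suc r)
      let ?w = "qbessel_weight fps_X q" and ?t = "s div Suc (Suc i')" and ?j = "s mod Suc (Suc i')"
      let ?A = "case_nat (vtx i s) ` SE_paths_to k (vtx i (Suc s))"
      have A: "sums_upto d (path_weight ?w) ?A (path_gf fps_X q k i (Suc s))"
      proof (rule sums_upto_image[OF _ inj_on_case_nat])
        show "sums_upto d (\<lambda>v. path_weight ?w (case_nat (vtx i s) v)) (SE_paths_to k (vtx i (Suc s)))
            (path_gf fps_X q k i (Suc s))"
          using Suc.IH[of "Suc s"] Suc.prems by (simp add: path_weight_south cong: sums_upto_cong)
      qed
      show ?case
      proof (cases "?j \<le> i'")
        case False
        have "SE_paths_to k (vtx i s) = ?A"
          using SE_paths_to_Suc[of k i' s] False 3 by simp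
        moreover have "path_gf fps_X q k i s = path_gf fps_X q k i (Suc s)"
          using path_gf_Suc[OF _ q \<open>k \<le> i'\<close>, of fps_X s] False 3 by simp
        ultimately show ?thesis
          using A by simp
      next
        case True
        let ?B = "case_nat (vtx i s) ` SE_paths_to k (vtx i' (s - ?t))"
        have B: "sums_upto d (path_weight ?w) ?B (?w ?t i' ?j * path_gf fps_X q k i' (s - ?t))"
        proof (rule sums_upto_image[OF _ inj_on_case_nat])
          have "sums_upto d (\<lambda>v. ?w ?t i' ?j * path_weight ?w v) (SE_paths_to k (vtx i' (s - ?t)))
            (?w ?t i' ?j * path_gf fps_X q k i' (s - ?t))"
            using less[of i'] 3 by (intro sums_upto_mult) simp
          then show "sums_upto d (\<lambda>v. path_weight ?w (case_nat (vtx i s) v)) (SE_paths_to k (vtx i' (s - ?t)))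
            (?w ?t i' ?j * path_gf fps_X q k i' (s - ?t))"
            using 3 True by (simp add: path_weight_east cong: sums_upto_cong)
        qed
        have "?A \<inter> ?B = {}"
        proof -
          \<comment> \<open>The two kinds of paths differ in the column of their penultimate
            vertex.\<close>
          have "v \<noteq> v'" if "v \<in> SE_paths_to k (vtx i (Suc s))" "v' \<in> SE_paths_to k (vtx i' (s - ?t))" for v v'
            using SE_paths_to_start[OF that(1)] SE_paths_to_start[OF that(2)] 3 by auto
          then show ?thesis
            using inj_onD[OF inj_on_case_nat[of "vtx i s" UNIV]] by blast
        qed
        moreover have "SE_paths_to k (vtx i s) = ?A \<union> ?B"
          using SE_paths_to_Suc[of k i' s] True 3 by simp
        moreover have "path_gf fps_X q k i s
            = path_gf fps_X q k i (Suc s) + ?w ?t i' ?j * path_gf fps_X q k i' (s - ?t)"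
          using path_gf_Suc[OF _ q \<open>k \<le> i'\<close>, of fps_X s] True 3 by simp
        ultimately show ?thesis
          using sums_upto_Un[OF A B] by simp
      qed
    qed
  qed
qed

lemma has_sum_paths:
  fixes q :: "'a::field fps"
  assumes q: "\<And>i. 0 < i \<Longrightarrow> q ^ i \<noteq> 1"
  shows "(path_weight (qbessel_weight fps_X q) has_sum moment_fps fps_X q n k) (SE_paths k n)"
proof -
  have "path_gf fps_X q k n 0 = moment_fps fps_X q n k"
    by (simp add: path_gf_def level_sum_0[OF _ q])
  then show ?thesis
    unfolding SE_paths_eq using sums_upto_paths[OF q] by (metis has_sum_of_sums_upto)
qed

section \<open>The indeterminates\<close>

text \<open>Used both for the embedding \<open>to_fract\<close> and for
  \<open>fps_of_poly\<close>.\<close>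

lemma qbin_hom:
  assumes "h 0 = 0" "h 1 = 1" "\<And>x y. h (x + y) = h x + h y" "\<And>x y. h (x * y) = h x * h y"
  shows "h (qbin q n k) = qbin (h q) n k"
proof -
  have "h (q ^ m) = h q ^ m" for m
    by (induction m) (simp_all add: assms)
  then show ?thesis
    by (induction q n k rule: qbin.induct) (simp_all add: assms)
qed

lemma qpoch_hom:
  assumes "h 1 = 1" "\<And>x y. h (x - y) = h x - h y" "\<And>x y. h (x * y) = h x * h y"
  shows "h (qpoch z q n) = qpoch (h z) (h q) n"
proof -
  have "h (q ^ m) = h q ^ m" for m
    by (induction m) (simp_all add: assms)
  then show ?thesis
    by (induction n) (simp_all add: assms qpoch_Suc)
qed

lemma to_fract_power: "to_fract (x ^ n) = to_fract x ^ n"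
  by (induction n) simp_all

lemma q_var_power_neq_1: "0 < i \<Longrightarrow> q_var ^ i \<noteq> 1"
proof
  assume i: "0 < i" and "q_var ^ i = 1"
  then have "[:0, 1:] ^ i = (1 :: rat poly)"
    by (simp add: q_var_def flip: to_fract_power to_fract_1)
  then have "degree ([:0, 1:] ^ i :: rat poly) = 0" by simp
  with i show False by (simp add: degree_linear_power)
qed

lemma const_poly_power: "[:c:] ^ i = [:c ^ i:]" for c :: "'a::comm_semiring_1"
  by (induction i) (simp_all add: one_pCons mult.commute)

theorem proposition4p8:
  fixes n k :: nat
  assumes "k \<le> n"
  shows "path_weight (qbessel_weight a_fps q_fps) summable_on SE_paths k n \<and>
    has_fps_expansion_rat (qbessel_mixed_moment a_rat q_rat n k)
      (lh_h (qbessel_weight a_fps q_fps) n k)"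
proof -
  have q_fps: "q_fps ^ i \<noteq> 1" if "0 < i" for i
  proof
    assume "q_fps ^ i = 1"
    then have "(q_fps ^ i) $ 0 = 1" by simp
    then show False
      using q_var_power_neq_1[OF that] by (simp add: q_fps_def)
  qed
  have sum: "(path_weight (qbessel_weight a_fps q_fps) has_sum moment_fps a_fps q_fps n k) (SE_paths k n)"
    unfolding a_fps_def by (rule has_sum_paths[OF q_fps])
  let ?q = "[:q_var:]" and ?X = "[:0, 1:] :: ratq poly"
  \<comment> \<open>Numerator and denominator are formed in the polynomials in a over Q(q), which
    map both to the rational functions and to the power series.\<close>
  define z where "z = - ?X * ?q ^ (2 * k + 1)"
  define u d where "u = qbin ?q n k" and "d = qpoch z ?q (n - k)"
  have q_var: "q_var \<noteq> 0" by (simp add: q_var_def)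
  have d0: "coeff d 0 = 1"
  proof -
    have "coeff (qpoch z ?q m) 0 = 1" for m
      by (induction m) (simp_all add: qpoch_Suc coeff_mult z_def)
    then show ?thesis by (simp add: d_def)
  qed
  have "qbessel_mixed_moment a_rat q_rat n k
      = qbin q_rat n k / qpoch (- a_rat * q_rat ^ (2 * k + 1)) q_rat (n - k)"
  proof (rule qbessel_mixed_moment_eq[OF _ _ _ assms])
    show "q_rat \<noteq> 0" using q_var by (simp add: q_rat_def)
  next
    fix i :: nat assume "0 < i"
    then have "?q ^ i \<noteq> 1"
      using q_var_power_neq_1 by (simp add: const_poly_power one_pCons)
    then show "q_rat ^ i \<noteq> 1"
      unfolding q_rat_def by (metis to_fract_power to_fract_1 to_fract_eq_iff)
  next
    fix i :: nat
    \<comment> \<open>The constant coefficient in a shows that 1 + a q^i is not zero.\<close>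
    have "coeff (1 + ?X * ?q ^ i) 0 = 1" by (simp add: coeff_mult)
    then have "1 + ?X * ?q ^ i \<noteq> 0" by (metis coeff_0 zero_neq_one)
    then have "to_fract (1 + ?X * ?q ^ i) \<noteq> 0" by (simp only: to_fract_eq_0_iff not_False_eq_True)
    then show "1 + a_rat * q_rat ^ i \<noteq> 0"
      by (simp only: a_rat_def q_rat_def to_fract_power to_fract_add to_fract_mult to_fract_1 not_False_eq_True)
  qed
  also have "qbin q_rat n k = to_fract u"
    unfolding q_rat_def u_def by (intro qbin_hom[symmetric]) simp_all
  also have "qpoch (- a_rat * q_rat ^ (2 * k + 1)) q_rat (n - k) = to_fract d"
  proof -
    have "to_fract d = qpoch (to_fract z) q_rat (n - k)"
      unfolding q_rat_def d_def by (intro qpoch_hom) simp_all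
    moreover have "to_fract z = - a_rat * q_rat ^ (2 * k + 1)"
      unfolding z_def a_rat_def q_rat_def by (simp only: to_fract_mult to_fract_power to_fract_uminus)
    ultimately show ?thesis by simp
  qed
  finally have r: "qbessel_mixed_moment a_rat q_rat n k = Fract u d"
    by (simp add: Fract_conv_to_fract)
  have "fps_of_poly u = qbin q_fps n k"
    unfolding q_fps_def u_def fps_of_poly_const[symmetric]
    by (intro qbin_hom) (simp_all add: fps_of_poly_add fps_of_poly_mult)
  moreover have "fps_of_poly d = qpoch (- a_fps * q_fps ^ (2 * k + 1)) q_fps (n - k)"
  proof -
    have "fps_of_poly d = qpoch (fps_of_poly z) q_fps (n - k)"
      unfolding q_fps_def d_def fps_of_poly_const[symmetric]
      by (intro qpoch_hom) (simp_all add: fps_of_poly_diff fps_of_poly_mult)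
    moreover have "fps_of_poly z = - a_fps * q_fps ^ (2 * k + 1)"
      unfolding z_def a_fps_def q_fps_def
      by (simp only: fps_of_poly_mult fps_of_poly_power fps_of_poly_uminus fps_of_poly_fps_X fps_of_poly_const)
    ultimately show ?thesis by simp
  qed
  moreover have "fps_of_poly d * inverse (fps_of_poly d) = 1"
    by (rule inverse_mult_eq_1') (simp add: d0)
  ultimately have "fps_of_poly d * moment_fps a_fps q_fps n k = fps_of_poly u"
    by (simp only: moment_fps_def) (metis mult.left_commute mult.right_neutral)
  then have "has_fps_expansion_rat (qbessel_mixed_moment a_rat q_rat n k) (moment_fps a_fps q_fps n k)"
    unfolding has_fps_expansion_rat_def using r d0 by (intro exI[of _ u] exI[of _ d]) simp
  then show ?thesis
    using sum by (auto simp: lh_h_def summable_on_def dest: infsumI)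
qed

end
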